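(* Let $\mathscr{L}$ be a Kolmogorov operator on $\mathbb{R}^{N+1}$ as described in the context (non-divergence form, block-structured constant drift matrix $B$, uniformly elliptic in the first $m_0$ variables, Hölder continuous coefficients), let $\Omega$ be any open subset of $\mathbb{R}^{N+1}$, and let $u \ge 0$ be a solution to $\mathscr{L} u = 0$ in $\Omega$. If $u(x_0,t_0) = 0$ for some point $(x_0,t_0) \in \Omega$, then $u(x,t) = 0$ for every $(x,t) \in \overline{\mathscr{A}_{(x_0,t_0)}(\Omega)} \cap \Omega$, where $\mathscr{A}_{(x_0,t_0)}(\Omega)$ is the attainable set of $(x_0,t_0)$ in $\Omega$ and the bar denotes closure.
   Context: **The operator.** Points of $\mathbb{R}^{N+1}$ are written $z=(x,t)$, $x\in\mathbb{R}^N$, $t\in\mathbb{R}$. The operator is $$\mathscr{L} = \sum_{i,j=1}^{m_0} a_{ij}(x,t)\,\partial^2_{x_ix_j} + \sum_{j=1}^{m_0} b_j(x,t)\,\partial_{x_j} + \langle Bx, D\rangle - \partial_t,$$ where $D=(\partial_{x_1},\dots,\partial_{x_N})$, $1\le m_0\le N$, and the following standing assumptions hold. (1) $B$ is a real constant $N\times N$ matrix of the block form $$B=\begin{pmatrix} * & * & \cdots & * & *\\ B_1 & * & \cdots & * & *\\ 0 & B_2 & \cdots & * & *\\ \vdots & \vdots & \ddots & \vdots & \vdots\\ 0 & 0 & \cdots & B_\kappa & * \end{pmatrix},$$ where each $B_j$ is an $m_j\times m_{j-1}$ matrix of rank $m_j$ ($j=1,\dots,\kappa$), the $m_j$ are positive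 integers with $m_0\ge m_1\ge\dots\ge m_\kappa\ge 1$ and $m_0+m_1+\dots+m_\kappa=N$, and the blocks $*$ are arbitrary. (2) $(a_{ij}(z))_{i,j=1,\dots,m_0}$ is symmetric and there is a constant $\lambda>0$ such that $\frac1\lambda\sum_{i=1}^{m_0}|\xi_i|^2\le\sum_{i,j=1}^{m_0}a_{ij}(z)\xi_i\xi_j\le\lambda\sum_{i=1}^{m_0}|\xi_i|^2$ for every $\xi\in\mathbb{R}^{m_0}$ and $z\in\mathbb{R}^{N+1}$. (3) There exist $0<\alpha\le1$ and $M>0$ such that $|a_{ij}(z)-a_{ij}(\zeta)|\le M\,d(z,\zeta)^\alpha$ and $|b_j(z)-b_j(\zeta)|\le M\,d(z,\zeta)^\alpha$ for all $z,\zeta\in\mathbb{R}^{N+1}$ and $i,j=1,\dots,m_0$. Here $d(z,\zeta)=\|z^{-1}\circ\zeta\|$, where, with $E(t)=\exp(-tB)$, the group law is $(x,t)\circ(\xi,\tau)=(\xi+E(\tau)x,\,t+\tau)$, the inverse is $(x,t)^{-1}=(-E(-t)x,-t)$, and $\|(x,t)\|=|t|^{1/2}+\sum_{j=1}^N|x_j|^{1/q_j}$, with $q_j=1$ for the first $m_0$ indices, $q_j=3$ for the next $m_1$ indices, and in general $q_j=2i+1$ for the $m_i$ indices of the $i$-th block ($i=0,\dots,\kappa$). **Solutions.** Let $Y=\langle Bx,D\rangle-\partial_t$. The Lie derivative of $u$ along $Y$ at $z=(x,t)$ is $Yu(z)=\lim_{s\to0}\frac{u(\gamma(s))-u(\gamma(0))}{s}$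 with $\gamma(s)=(E(-s)x,\,t-s)$, when this limit exists and is finite. A function $u$ is a solution to $\mathscr{L}u=0$ in an open set $\Omega$ if the derivatives $\partial_{x_i}u,\ \partial^2_{x_ix_j}u$ ($i,j=1,\dots,m_0$) and the Lie derivative $Yu$ exist and are continuous in $\Omega$, and $\sum_{i,j=1}^{m_0} a_{ij}\partial^2_{x_ix_j}u+\sum_{j=1}^{m_0} b_j\partial_{x_j}u+Yu=0$ at every point of $\Omega$. **Admissible curves and attainable set.** A curve $\gamma:[0,T]\to\mathbb{R}^{N+1}$ is $\mathscr{L}$-admissible if it is absolutely continuous and $$\dot\gamma(s)=\sum_{k=1}^{m_0}\omega_k(s)X_k(\gamma(s))+Y(\gamma(s))\quad\text{for a.e. } s\in[0,T],$$ for some $\omega_1,\dots,\omega_{m_0}\in L^1[0,T]$, where $X_k=\partial_{x_k}$ (the $k$-th coordinate vector) and $Y(x,t)=(Bx,-1)$. For $(x_0,t_0)\in\Omega$, the attainable set $\mathscr{A}_{(x_0,t_0)}(\Omega)$ is the set of all $(x,t)\in\Omega$ for which there is an $\mathscr{L}$-admissible curve $\gamma:[0,T]\to\Omega$ with $\gamma(0)=(x_0,t_0)$ and $\gamma(T)=(x,t)$. *)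

theory Defs
  imports "HOL-Analysis.Analysis"
begin

type_synonym 'n point = "(real, 'n) vec \<times> real"
type_synonym 'n sqmat = "((real, 'n) vec, 'n) vec"

text \<open>
  Space-time points \<open>z = (x, t)\<close> have type \<open>'n point\<close>, with \<open>N = CARD('n)\<close>. The index
  type \<open>'n\<close> is linearly ordered so that "the first \<open>m\<^sub>0\<close> variables" makes sense; an index
  \<open>i :: 'n\<close> has the (zero-based) position \<open>idx i\<close> among \<open>0, \<dots>, N - 1\<close>.
\<close>

definition idx :: "'n::{finite,linorder} \<Rightarrow> nat" where
  "idx i = card {k. k < i}"

text \<open>
  For block sizes \<open>m 0, m 1, \<dots>\<close> the block containing coordinate \<open>i\<close> (blocks are numbered from 0).
  This is meaningful when the block sizes add up to at least \<open>N\<close>, as is required in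
  \<open>drift_block_form\<close> below.
\<close>

definition block_of :: "(nat \<Rightarrow> nat) \<Rightarrow> 'n::{finite,linorder} \<Rightarrow> nat" where
  "block_of m i = (LEAST k. idx i < (\<Sum>l\<le>k. m l))"

definition first_block :: "(nat \<Rightarrow> nat) \<Rightarrow> 'n::{finite,linorder} set" where
  "first_block m = {i. idx i < m 0}"

text \<open>
  The \<open>m k \<times> m (k - 1)\<close> block \<open>B\<^sub>k\<close> in block row \<open>k\<close> and block column \<open>k - 1\<close>, padded with zeros
  to an \<open>N \<times> N\<close> matrix; padding with zero rows and columns does not change the rank.
\<close>

definition subdiag_block ::
    "(nat \<Rightarrow> nat) \<Rightarrow> 'n::{finite,linorder} sqmat \<Rightarrow> nat \<Rightarrow> 'n sqmat" where
  "subdiag_block m B k =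
     (\<chi> i j. if block_of m i = k \<and> block_of m j + 1 = k then B $ i $ j else 0)"

definition drift_block_form ::
    "nat \<Rightarrow> (nat \<Rightarrow> nat) \<Rightarrow> 'n::{finite,linorder} sqmat \<Rightarrow> bool" where
  "drift_block_form \<kappa> m B \<longleftrightarrow>
     (\<forall>k\<le>\<kappa>. 1 \<le> m k) \<and>
     (\<forall>k<\<kappa>. m (Suc k) \<le> m k) \<and>
     (\<Sum>k\<le>\<kappa>. m k) = CARD('n) \<and>
     (\<forall>i j. block_of m i > block_of m j + 1 \<longrightarrow> B $ i $ j = 0) \<and>
     (\<forall>k\<in>{1..\<kappa>}. rank (subdiag_block m B k) = m k)"

text \<open>
  The library power \<open>A ^ k\<close> on \<open>real^'n^'n\<close> is componentwise, hence the separate definition of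
  powers with respect to the matrix product and of the matrix exponential.
\<close>

primrec mat_pow :: "'n::finite sqmat \<Rightarrow> nat \<Rightarrow> 'n sqmat" where
  "mat_pow A 0 = mat 1"
| "mat_pow A (Suc k) = A ** mat_pow A k"

definition mat_exp :: "'n::finite sqmat \<Rightarrow> 'n sqmat" where
  "mat_exp A = (\<Sum>k. (1 / fact k) *\<^sub>R mat_pow A k)"

definition E_mat :: "'n::finite sqmat \<Rightarrow> real \<Rightarrow> 'n sqmat" where
  "E_mat B t = mat_exp ((- t) *\<^sub>R B)"

definition kol_mult ::
    "'n::finite sqmat \<Rightarrow> 'n point \<Rightarrow> 'n point \<Rightarrow> 'n point" where
  "kol_mult B z \<zeta> = (fst \<zeta> + E_mat B (snd \<zeta>) *v fst z, snd z + snd \<zeta>)"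

definition kol_inv :: "'n::finite sqmat \<Rightarrow> 'n point \<Rightarrow> 'n point" where
  "kol_inv B z = (- (E_mat B (- snd z) *v fst z), - snd z)"

definition kol_norm :: "(nat \<Rightarrow> nat) \<Rightarrow> 'n::{finite,linorder} point \<Rightarrow> real" where
  "kol_norm m z =
     \<bar>snd z\<bar> powr (1 / 2) + (\<Sum>j\<in>UNIV. \<bar>fst z $ j\<bar> powr (1 / real (2 * block_of m j + 1)))"

definition kol_dist ::
    "(nat \<Rightarrow> nat) \<Rightarrow> 'n::{finite,linorder} sqmat \<Rightarrow> 'n point \<Rightarrow> 'n point \<Rightarrow> real"
  where "kol_dist m B z \<zeta> = kol_norm m (kol_mult B (kol_inv B z) \<zeta>)"

text \<open>
  The coefficients are indexed by all of \<open>'n\<close>, but here and below only their values at indices in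
  \<open>first_block m\<close> are used.
\<close>

definition uniformly_elliptic ::
    "(nat \<Rightarrow> nat) \<Rightarrow> ('n::{finite,linorder} \<Rightarrow> 'n \<Rightarrow> 'n point \<Rightarrow> real) \<Rightarrow> bool" where
  "uniformly_elliptic m a \<longleftrightarrow>
     (\<forall>i\<in>first_block m. \<forall>j\<in>first_block m. \<forall>z. a i j z = a j i z) \<and>
     (\<exists>\<Lambda>>0. \<forall>(\<xi> :: 'n \<Rightarrow> real) z.
        (1 / \<Lambda>) * (\<Sum>i\<in>first_block m. \<bar>\<xi> i\<bar>\<^sup>2)
          \<le> (\<Sum>i\<in>first_block m. \<Sum>j\<in>first_block m. a i j z * \<xi> i * \<xi> j) \<and>
        (\<Sum>i\<in>first_block m. \<Sum>j\<in>first_block m. a i j z * \<xi> i * \<xi> j)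
          \<le> \<Lambda> * (\<Sum>i\<in>first_block m. \<bar>\<xi> i\<bar>\<^sup>2))"

definition hoelder_coefficients ::
    "(nat \<Rightarrow> nat) \<Rightarrow> 'n::{finite,linorder} sqmat \<Rightarrow> ('n \<Rightarrow> 'n \<Rightarrow> 'n point \<Rightarrow> real) \<Rightarrow>
      ('n \<Rightarrow> 'n point \<Rightarrow> real) \<Rightarrow> bool" where
  "hoelder_coefficients m B a b \<longleftrightarrow>
     (\<exists>\<alpha> M. 0 < \<alpha> \<and> \<alpha> \<le> 1 \<and> 0 < M \<and>
        (\<forall>z \<zeta>. \<forall>i\<in>first_block m. \<forall>j\<in>first_block m.
           \<bar>a i j z - a i j \<zeta>\<bar> \<le> M * kol_dist m B z \<zeta> powr \<alpha> \<and>
           \<bar>b j z - b j \<zeta>\<bar> \<le> M * kol_dist m B z \<zeta> powr \<alpha>))"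

definition kolmogorov_operator ::
    "nat \<Rightarrow> (nat \<Rightarrow> nat) \<Rightarrow> 'n::{finite,linorder} sqmat \<Rightarrow>
      ('n \<Rightarrow> 'n \<Rightarrow> 'n point \<Rightarrow> real) \<Rightarrow>
      ('n \<Rightarrow> 'n point \<Rightarrow> real) \<Rightarrow> bool" where
  "kolmogorov_operator \<kappa> m B a b \<longleftrightarrow>
     drift_block_form \<kappa> m B \<and> uniformly_elliptic m a \<and> hoelder_coefficients m B a b"

definition space_line :: "'n::finite \<Rightarrow> 'n point \<Rightarrow> real \<Rightarrow> 'n point" where
  "space_line i z h = (fst z + h *\<^sub>R axis i 1, snd z)"

definition has_partial :: "'n::finite \<Rightarrow> ('n point \<Rightarrow> real) \<Rightarrow> 'n point \<Rightarrow> bool" where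
  "has_partial i u z \<longleftrightarrow> (\<lambda>h. u (space_line i z h)) field_differentiable at 0"

definition partial :: "'n::finite \<Rightarrow> ('n point \<Rightarrow> real) \<Rightarrow> 'n point \<Rightarrow> real" where
  "partial i u z = deriv (\<lambda>h. u (space_line i z h)) 0"

definition Y_curve :: "'n::finite sqmat \<Rightarrow> 'n point \<Rightarrow> real \<Rightarrow> 'n point" where
  "Y_curve B z s = (E_mat B (- s) *v fst z, snd z - s)"

definition has_lie_deriv ::
    "'n::finite sqmat \<Rightarrow> ('n point \<Rightarrow> real) \<Rightarrow> 'n point \<Rightarrow> bool" where
  "has_lie_deriv B u z \<longleftrightarrow>
     (\<exists>L. ((\<lambda>s. (u (Y_curve B z s) - u (Y_curve B z 0)) / s) \<longlongrightarrow> L) (at 0))"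

definition lie_deriv ::
    "'n::finite sqmat \<Rightarrow> ('n point \<Rightarrow> real) \<Rightarrow> 'n point \<Rightarrow> real" where
  "lie_deriv B u z = Lim (at 0) (\<lambda>s. (u (Y_curve B z s) - u (Y_curve B z 0)) / s)"

text \<open>
  The function \<open>u\<close> is total, but only its values on the open set \<open>\<Omega>\<close> enter. Continuity of \<open>u\<close>
  itself is not part of the definition.
\<close>

definition is_solution ::
    "(nat \<Rightarrow> nat) \<Rightarrow> 'n::{finite,linorder} sqmat \<Rightarrow> ('n \<Rightarrow> 'n \<Rightarrow> 'n point \<Rightarrow> real) \<Rightarrow>
      ('n \<Rightarrow> 'n point \<Rightarrow> real) \<Rightarrow> 'n point set \<Rightarrow>
      ('n point \<Rightarrow> real) \<Rightarrow> bool" where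
  "is_solution m B a b \<Omega> u \<longleftrightarrow>
     (\<forall>i\<in>first_block m. (\<forall>z\<in>\<Omega>. has_partial i u z) \<and> continuous_on \<Omega> (partial i u)) \<and>
     (\<forall>i\<in>first_block m. \<forall>j\<in>first_block m.
        (\<forall>z\<in>\<Omega>. has_partial i (partial j u) z) \<and> continuous_on \<Omega> (partial i (partial j u))) \<and>
     (\<forall>z\<in>\<Omega>. has_lie_deriv B u z) \<and> continuous_on \<Omega> (lie_deriv B u) \<and>
     (\<forall>z\<in>\<Omega>.
        (\<Sum>i\<in>first_block m. \<Sum>j\<in>first_block m. a i j z * partial i (partial j u) z)
        + (\<Sum>j\<in>first_block m. b j z * partial j u z)
        + lie_deriv B u z = 0)"

text \<open>
  Absolute continuity of a curve on \<open>{c..d}\<close>: \<open>P\<close> is a finite family of non-overlapping closed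
  subintervals \<open>{p..q}\<close>, given by their endpoint pairs \<open>(p, q)\<close>.
\<close>

definition absolutely_continuous_curve :: "real \<Rightarrow> real \<Rightarrow> (real \<Rightarrow> 'a::metric_space) \<Rightarrow> bool" where
  "absolutely_continuous_curve c d \<gamma> \<longleftrightarrow>
     (\<forall>\<epsilon>>0. \<exists>\<delta>>0. \<forall>P :: (real \<times> real) set.
        finite P \<and> (\<forall>(p, q)\<in>P. c \<le> p \<and> p \<le> q \<and> q \<le> d) \<and>
        pairwise (\<lambda>I J. disjnt {fst I<..<snd I} {fst J<..<snd J}) P \<and>
        (\<Sum>(p, q)\<in>P. q - p) < \<delta>
        \<longrightarrow> (\<Sum>(p, q)\<in>P. dist (\<gamma> p) (\<gamma> q)) < \<epsilon>)"

definition admissible_curve ::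
    "(nat \<Rightarrow> nat) \<Rightarrow> 'n::{finite,linorder} sqmat \<Rightarrow> real \<Rightarrow> (real \<Rightarrow> 'n point) \<Rightarrow> bool" where
  "admissible_curve m B T \<gamma> \<longleftrightarrow>
     absolutely_continuous_curve 0 T \<gamma> \<and>
     (\<exists>\<omega> :: 'n \<Rightarrow> real \<Rightarrow> real.
        (\<forall>k\<in>first_block m. \<omega> k absolutely_integrable_on {0..T}) \<and>
        (AE s in lebesgue_on {0..T}.
           (\<gamma> has_vector_derivative
              ((\<Sum>k\<in>first_block m. \<omega> k s *\<^sub>R (axis k 1, 0)) + (B *v fst (\<gamma> s), - 1)))
           (at s within {0..T})))"

text \<open>
  The degenerate case \<open>T = 0\<close> is allowed, so a point of \<open>\<Omega>\<close> is attainable from itself; this does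
  not affect the closure relative to \<open>\<Omega>\<close>.
\<close>

definition attainable_set ::
    "(nat \<Rightarrow> nat) \<Rightarrow> 'n::{finite,linorder} sqmat \<Rightarrow> 'n point set \<Rightarrow>
      'n point \<Rightarrow> 'n point set" where
  "attainable_set m B \<Omega> z\<^sub>0 =
     {z\<in>\<Omega>. \<exists>T\<ge>0. \<exists>\<gamma>. admissible_curve m B T \<gamma> \<and> \<gamma> ` {0..T} \<subseteq> \<Omega> \<and> \<gamma> 0 = z\<^sub>0 \<and> \<gamma> T = z}"

end

(*
The zero set F of u is relatively closed in \<Omega>, because the commutators of the fields X_i and Y span
all directions and hence u is continuous. At a point of F with outer normal \<nu>, a local barrier shows
first that \<nu> is orthogonal to the X_i, so that F is invariant under horizontal shifts, and then that
\<nu> \<bullet> Y \<le> 0. Hence the squared distance to F along an admissible curve satisfies a Gronwall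
inequality (Bony, Nagumo), and admissible curves starting in F stay in F.
*)

theory Submission
  imports Defs
begin

text \<open>A solution has derivatives only along the fields \<open>X_field i\<close> and along the
  flow of Y. Minima are therefore tested along single horizontal lines and along a single flow line,
  against explicit quadratic polynomials, and continuity of \<open>u\<close> comes from joining
  points by finitely many flow lines and horizontal segments.

  The order of the two statements on normals is forced. For an arbitrary ball touching the zero set,
  the second-order terms due to its curvature may outweigh the first-order term \<nu> \<bullet> Y.
  If \<nu> has a horizontal component, a large multiple of the square of the linear form \<nu>
  dominates everything by ellipticity. If it has none, horizontal invariance allows the ball to be
  replaced by an ellipsoid whose curvature in the horizontal directions is as small as desired, and
  then the first-order term decides.

  Orthogonality also removes the controls from the inequality for the distance. What remains is the
  linear field Y, whose Lipschitz constant is the constant in that inequality.\<close>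

section \<open>Trace of a product of positive forms\<close>

lemma sum_sum_insert:
  fixes f :: "'i \<Rightarrow> 'i \<Rightarrow> real"
  assumes "finite I" "p \<notin> I"
  shows "(\<Sum>i\<in>insert p I. \<Sum>j\<in>insert p I. f i j) =
         f p p + (\<Sum>j\<in>I. f p j) + (\<Sum>i\<in>I. f i p) + (\<Sum>i\<in>I. \<Sum>j\<in>I. f i j)"
  using assms by (simp add: sum.distrib)

text \<open>Needed at an interior minimum, where \<open>a\<close> is the coefficient matrix and
  \<open>H\<close> a horizontal Hessian that is not assumed symmetric. \<open>H\<close> stays fixed
  in the induction while \<open>a\<close> loses one index at a time; the rank-one part split off
  contributes the form \<open>H\<close> at column \<open>p\<close> of \<open>a\<close>, divided by
  \<open>a p p\<close>.\<close>

lemma trace_product_nonneg: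
  fixes a H :: "'i \<Rightarrow> 'i \<Rightarrow> real"
  assumes "finite I"
    and "\<And>i j. i \<in> I \<Longrightarrow> j \<in> I \<Longrightarrow> a i j = a j i"
    and "\<And>\<xi>. \<exists>i\<in>I. \<xi> i \<noteq> 0 \<Longrightarrow> 0 < (\<Sum>i\<in>I. \<Sum>j\<in>I. a i j * \<xi> i * \<xi> j)"
    and "\<And>\<xi>. 0 \<le> (\<Sum>i\<in>I. \<Sum>j\<in>I. H i j * \<xi> i * \<xi> j)"
  shows "0 \<le> (\<Sum>i\<in>I. \<Sum>j\<in>I. a i j * H i j)"
  using assms
proof (induction I arbitrary: a rule: finite_induct)
  case empty
  then show ?case by simp
next
  case (insert p I)
  note sym = insert.prems(1) and pd = insert.prems(2) and psd = insert.prems(3)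
  have app: "0 < a p p"
  proof -
    have "0 < (\<Sum>i\<in>insert p I. \<Sum>j\<in>insert p I. a i j * (of_bool (i = p)) * (of_bool (j = p)))"
      by (rule pd) auto
    also have "\<dots> = a p p"
      using insert.hyps by (subst sum_sum_insert) (auto intro!: sum.neutral)
    finally show ?thesis .
  qed
  text \<open>One step of Gaussian elimination: \<open>a\<close> is a rank-one form plus its Schur complement \<open>a'\<close>.\<close>
  define a' where "a' i j = a i j - a i p * a j p / a p p" for i j
  have a'p: "a' p j = 0" "a' j p = 0" if "j \<in> insert p I" for j
    using app sym[of p j] that by (auto simp: a'_def)
  have pd': "0 < (\<Sum>i\<in>I. \<Sum>j\<in>I. a' i j * \<xi> i * \<xi> j)" if nz: "\<exists>i\<in>I. \<xi> i \<noteq> 0" for \<xi>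
  proof -
    define S where "S = (\<Sum>i\<in>I. a i p * \<xi> i)"
    \<comment> \<open>Completing the square: this value at \<open>p\<close> minimises the form of
      \<open>a\<close> in that coordinate, and the minimum is the form of \<open>a'\<close>.\<close>
    define \<eta> where "\<eta> = \<xi>(p := - S / a p p)"
    have \<eta>I: "\<eta> i = \<xi> i" if "i \<in> I" for i using that insert.hyps by (auto simp: \<eta>_def)
    have "0 < (\<Sum>i\<in>insert p I. \<Sum>j\<in>insert p I. a i j * \<eta> i * \<eta> j)"
      by (rule pd) (use nz \<eta>I in auto)
    also have "\<dots> = a p p * \<eta> p * \<eta> p + (\<Sum>j\<in>I. a p j * \<eta> p * \<eta> j)
        + (\<Sum>i\<in>I. a i p * \<eta> i * \<eta> p) + (\<Sum>i\<in>I. \<Sum>j\<in>I. a i j * \<eta> i * \<eta> j)"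
      by (rule sum_sum_insert) (use insert.hyps in auto)
    also have "(\<Sum>j\<in>I. a p j * \<eta> p * \<eta> j) = \<eta> p * S"
      unfolding S_def sum_distrib_left
      by (intro sum.cong refl) (use sym \<eta>I in \<open>auto simp: mult_ac\<close>)
    also have "(\<Sum>i\<in>I. a i p * \<eta> i * \<eta> p) = \<eta> p * S"
      unfolding S_def sum_distrib_left
      by (intro sum.cong refl) (use sym \<eta>I in \<open>auto simp: mult_ac\<close>)
    also have "a p p * \<eta> p * \<eta> p + \<eta> p * S + \<eta> p * S = - (S * S / a p p)"
      using app by (simp add: \<eta>_def field_simps)
    also have "S * S / a p p = (\<Sum>i\<in>I. \<Sum>j\<in>I. a i p * a j p / a p p * \<xi> i * \<xi> j)"
      unfolding S_def sum_product sum_divide_distrib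
      by (intro sum.cong refl) (simp add: mult_ac)
    also have "(\<Sum>i\<in>I. \<Sum>j\<in>I. a i j * \<eta> i * \<eta> j) = (\<Sum>i\<in>I. \<Sum>j\<in>I. a i j * \<xi> i * \<xi> j)"
      by (intro sum.cong refl) (simp add: \<eta>I)
    also have "- (\<Sum>i\<in>I. \<Sum>j\<in>I. a i p * a j p / a p p * \<xi> i * \<xi> j)
        + (\<Sum>i\<in>I. \<Sum>j\<in>I. a i j * \<xi> i * \<xi> j) = (\<Sum>i\<in>I. \<Sum>j\<in>I. a' i j * \<xi> i * \<xi> j)"
      by (simp add: a'_def left_diff_distrib sum_subtractf)
    finally show ?thesis .
  qed
  have psd': "0 \<le> (\<Sum>i\<in>I. \<Sum>j\<in>I. H i j * \<xi> i * \<xi> j)" for \<xi>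
  proof -
    have "0 \<le> (\<Sum>i\<in>insert p I. \<Sum>j\<in>insert p I. H i j * (\<xi>(p := 0)) i * (\<xi>(p := 0)) j)"
      by (rule psd)
    also have "\<dots> = (\<Sum>i\<in>I. \<Sum>j\<in>I. H i j * (\<xi>(p := 0)) i * (\<xi>(p := 0)) j)"
      using insert.hyps by (subst sum_sum_insert) auto
    also have "\<dots> = (\<Sum>i\<in>I. \<Sum>j\<in>I. H i j * \<xi> i * \<xi> j)"
      using insert.hyps by (intro sum.cong refl) (auto simp: fun_upd_def)
    finally show ?thesis .
  qed
  have "0 \<le> (\<Sum>i\<in>I. \<Sum>j\<in>I. a' i j * H i j)"
    by (rule insert.IH[OF _ pd' psd']) (use sym in \<open>auto simp: a'_def mult_ac\<close>)
  also have "\<dots> = (\<Sum>i\<in>insert p I. \<Sum>j\<in>insert p I. a' i j * H i j)"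
    using insert.hyps by (simp add: sum_sum_insert a'p)
  finally have 1: "0 \<le> (\<Sum>i\<in>insert p I. \<Sum>j\<in>insert p I. a' i j * H i j)" .
  have "0 \<le> (\<Sum>i\<in>insert p I. \<Sum>j\<in>insert p I. H i j * a i p * a j p) / a p p"
    using psd[of "\<lambda>i. a i p"] app by simp
  then have "0 \<le> (\<Sum>i\<in>insert p I. \<Sum>j\<in>insert p I. H i j * a i p * a j p / a p p)"
    by (simp only: sum_divide_distrib)
  with 1 have "0 \<le> (\<Sum>i\<in>insert p I. \<Sum>j\<in>insert p I. a' i j * H i j + H i j * a i p * a j p / a p p)"
    unfolding sum.distrib by simp
  also have "\<dots> = (\<Sum>i\<in>insert p I. \<Sum>j\<in>insert p I. a i j * H i j)"
    by (intro sum.cong refl) (simp add: a'_def algebra_simps)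
  finally show ?case .
qed

section \<open>Absolutely continuous curves and a growth bound\<close>

lemma absolutely_continuous_curve_imp_continuous:
  assumes "absolutely_continuous_curve a b f"
  shows "continuous_on {a..b} f"
  unfolding continuous_on_iff
proof (intro ballI allI impI)
  fix x and e :: real
  assume x: "x \<in> {a..b}" and "e > 0"
  then obtain d where d: "d > 0" and *: "\<And>P. finite P \<and> (\<forall>(p, q)\<in>P. a \<le> p \<and> p \<le> q \<and> q \<le> b) \<and>
        pairwise (\<lambda>I J. disjnt {fst I<..<snd I} {fst J<..<snd J}) P \<and>
        (\<Sum>(p, q)\<in>P. q - p) < d \<Longrightarrow> (\<Sum>(p, q)\<in>P. dist (f p) (f q)) < e"
    using assms unfolding absolutely_continuous_curve_def by meson
  have "dist (f x') (f x) < e" if "x' \<in> {a..b}" "dist x' x < d" for x'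
    using *[of "{(min x x', max x x')}"] x that
    by (cases "x \<le> x'") (auto simp: dist_real_def min_def max_def dist_commute)
  with d show "\<exists>d>0. \<forall>x'\<in>{a..b}. dist x' x < d \<longrightarrow> dist (f x') (f x) < e" by blast
qed

text \<open>The supremum of the initial segments on which \<open>P\<close> holds is itself reached
  by \<open>limit\<close>, and \<open>step\<close> excludes that it is less than \<open>b\<close>.
  Both hypotheses look to one side only, which suits bounds on right difference quotients.\<close>

lemma real_interval_induct [consumes 1, case_names start limit step]:
  fixes a b :: real
  assumes ab: "a \<le> b" and start: "P a"
    and limit: "\<And>c. a < c \<Longrightarrow> c \<le> b \<Longrightarrow> (\<And>r. a \<le> r \<Longrightarrow> r < c \<Longrightarrow> P r) \<Longrightarrow> P c"
    and step: "\<And>c. a \<le> c \<Longrightarrow> c < b \<Longrightarrow> (\<And>r. a \<le> r \<Longrightarrow> r \<le> c \<Longrightarrow> P r) \<Longrightarrow>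
                \<exists>d>0. \<forall>r. c < r \<and> r < c + d \<longrightarrow> P r"
  shows "P b"
proof -
  define S where "S = {s \<in> {a..b}. \<forall>r\<in>{a..s}. P r}"
  define c where "c = Sup S"
  have "a \<in> S" using ab start by (auto simp: S_def)
  have bS: "bdd_above S" by (auto simp: S_def intro!: bdd_aboveI[of _ b])
  have "a \<le> c" unfolding c_def using \<open>a \<in> S\<close> bS by (rule cSup_upper)
  have "c \<le> b" unfolding c_def using \<open>a \<in> S\<close> by (intro cSup_least) (auto simp: S_def)
  have below: "P r" if "a \<le> r" "r < c" for r
  proof -
    obtain s where "s \<in> S" "r < s" using \<open>r < c\<close> \<open>a \<in> S\<close> bS unfolding c_def
      by (metis less_cSup_iff empty_iff)
    then show ?thesis using \<open>a \<le> r\<close> by (auto simp: S_def)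
  qed
  have "P c" using limit[of c] below \<open>a \<le> c\<close> \<open>c \<le> b\<close> start by (cases "a = c") auto
  then have upto: "P r" if "a \<le> r" "r \<le> c" for r
    using below that by (cases "r = c") auto
  have "c = b"
  proof (rule ccontr)
    assume "c \<noteq> b"
    then have "c < b" using \<open>c \<le> b\<close> by simp
    then obtain d where d: "d > 0" "\<And>r. c < r \<and> r < c + d \<Longrightarrow> P r"
      using step[of c] \<open>a \<le> c\<close> upto by blast
    define s where "s = c + min d (b - c) / 2"
    have s: "c < s" "s < c + d" "s \<le> b"
      using d \<open>c < b\<close> by (auto simp: s_def min_def field_simps)
    have "P r" if "a \<le> r" "r \<le> s" for r
      using upto[of r] d(2)[of r] that s by (cases "r \<le> c") auto
    then have "s \<in> S" using s \<open>a \<le> c\<close> by (auto simp: S_def)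
    then have "s \<le> c" unfolding c_def using bS by (rule cSup_upper)
    then show False using s by simp
  qed
  then show ?thesis using \<open>P c\<close> by simp
qed

text \<open>
  The monotone function \<open>V\<close> in the proof measures the variation of \<open>f\<close> inside a small open set
  covering the exceptional points; absolute continuity makes it small.
\<close>

lemma absolutely_continuous_growth_bound:
  fixes f :: "real \<Rightarrow> real"
  assumes ac: "absolutely_continuous_curve a b f" and ab: "a \<le> b" and N: "negligible N"
    and K: "0 \<le> K"
    and D: "\<And>s e. s \<in> {a..<b} - N \<Longrightarrow> e > 0 \<Longrightarrow>
              \<exists>d>0. \<forall>h. 0 < h \<and> h < d \<longrightarrow> f (s + h) - f s \<le> (K + e) * h"
  shows "f b - f a \<le> K * (b - a)"
proof -
  \<comment> \<open>The factor \<open>K + e\<close> absorbs the error of the difference quotients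
    outside \<open>N\<close>; the summand \<open>e\<close> is the variation spent in a neighbourhood
    of \<open>N\<close>.\<close>
  have main: "f b - f a \<le> (K + e) * (b - a) + e" if e: "e > 0" for e
  proof -
    obtain d where d: "d > 0" and dP: "\<And>P. finite P \<and> (\<forall>(p, q)\<in>P. a \<le> p \<and> p \<le> q \<and> q \<le> b) \<and>
        pairwise (\<lambda>I J. disjnt {fst I<..<snd I} {fst J<..<snd J}) P \<and>
        (\<Sum>(p, q)\<in>P. q - p) < d \<Longrightarrow> (\<Sum>(p, q)\<in>P. dist (f p) (f q)) < e"
      using ac e unfolding absolutely_continuous_curve_def by meson
    obtain U where U: "open U" "N \<subseteq> U" "U \<in> lmeasurable" "measure lebesgue U < d"
    proof -
      have null: "N \<in> null_sets lebesgue"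
        using N by (simp add: negligible_iff_null_sets)
      then have Ns: "N \<in> sets lebesgue" by blast
      obtain T where T: "open T" "N \<subseteq> T" "T - N \<in> lmeasurable"
          "emeasure lebesgue (T - N) < ennreal d"
        using sets_lebesgue_outer_open[OF Ns d] by blast
      have "measure lebesgue (T - N) < d"
        using T(3,4) by (metis emeasure_eq_measure2 ennreal_leI linorder_not_le)
      moreover have "T \<in> lmeasurable"
        using fmeasurable.Un[OF T(3) fmeasurableI_null_sets[OF null]] T(2)
        by (simp add: Un_absorb2)
      ultimately show ?thesis
        using T(1,2) null by (intro that) (auto simp: measure_Diff_null_set)
    qed
    define good where "good s P \<longleftrightarrow> finite P \<and>
        (\<forall>(p, q)\<in>P. a \<le> p \<and> p \<le> q \<and> q \<le> s \<and> {p..q} \<subseteq> U) \<and>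
        pairwise (\<lambda>I J. disjnt {fst I<..<snd I} {fst J<..<snd J}) P" for s and P :: "(real \<times> real) set"
    define vs where "vs s = (\<lambda>P. \<Sum>(p, q)\<in>P. dist (f p) (f q)) ` Collect (good s)" for s
    define V where "V s = Sup (vs s)" for s
    have good_less: "(\<Sum>(p, q)\<in>P. dist (f p) (f q)) < e" if g: "good s P" and "s \<le> b" for s P
    proof (rule dP, intro conjI)
      show "finite P" "pairwise (\<lambda>I J. disjnt {fst I<..<snd I} {fst J<..<snd J}) P"
        using g by (auto simp: good_def)
      show "\<forall>(p, q)\<in>P. a \<le> p \<and> p \<le> q \<and> q \<le> b"
        using g \<open>s \<le> b\<close> unfolding good_def by fastforce
      have "(\<Sum>(p, q)\<in>P. q - p) = (\<Sum>I\<in>P. measure lebesgue {fst I<..<snd I})"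
        using g unfolding good_def by (intro sum.cong refl) auto
      also have "\<dots> = measure lebesgue (\<Union>I\<in>P. {fst I<..<snd I})"
        using g unfolding good_def by (subst measure_UNION') auto
      also have "\<dots> \<le> measure lebesgue U"
      proof (rule measure_mono_fmeasurable)
        show "(\<Union>I\<in>P. {fst I<..<snd I}) \<subseteq> U"
          using g unfolding good_def by (fastforce simp: subset_iff)
        show "(\<Union>I\<in>P. {fst I<..<snd I}) \<in> sets lebesgue" 
          using g unfolding good_def by (intro sets.finite_UN) auto
      qed (rule U)
      finally show "(\<Sum>(p, q)\<in>P. q - p) < d" using U by linarith
    qed
    have bdd: "bdd_above (vs s)" if "s \<le> b" for s
      unfolding vs_def using good_less[OF _ that] by (auto intro!: bdd_aboveI2[of _ _ e] less_imp_le)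
    have good_empty: "good s {}" for s by (simp add: good_def)
    have Ve: "V s \<le> e" if "s \<le> b" for s
      unfolding V_def vs_def using good_empty good_less[OF _ that]
      by (intro cSup_least) (auto intro: less_imp_le)
    have V_mono: "V s \<le> V r" if "s \<le> r" "r \<le> b" for s r
      unfolding V_def
    proof (rule cSup_subset_mono)
      show "vs s \<noteq> {}" using good_empty unfolding vs_def by blast
      show "bdd_above (vs r)" by (rule bdd) fact
      have "good r P" if "good s P" for P
        using that \<open>s \<le> r\<close> unfolding good_def by fastforce
      then show "vs s \<subseteq> vs r" unfolding vs_def by blast
    qed
    have V_step: "V s + dist (f s) (f q) \<le> V q"
      if "a \<le> s" "s < q" "q \<le> b" "{s..q} \<subseteq> U" for s q
    proof -
      have "x \<le> V q - dist (f s) (f q)" if x: "x \<in> vs s" for x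
      proof -
        obtain P where P: "good s P" "x = (\<Sum>(p, q)\<in>P. dist (f p) (f q))"
          using x unfolding vs_def by blast
        have notin: "(s, q) \<notin> P" using P(1) \<open>s < q\<close> unfolding good_def by fastforce
        have "good q (insert (s, q) P)"
          using P(1) that \<open>a \<le> s\<close> \<open>s < q\<close> \<open>{s..q} \<subseteq> U\<close> unfolding good_def
          by (fastforce simp: pairwise_insert disjnt_iff)
        then have "(\<Sum>(p, q)\<in>insert (s, q) P. dist (f p) (f q)) \<in> vs q"
          unfolding vs_def by blast
        then have "(\<Sum>(p, q)\<in>insert (s, q) P. dist (f p) (f q)) \<le> V q"
          unfolding V_def using bdd[OF \<open>q \<le> b\<close>] by (rule cSup_upper)
        moreover have "finite P" using P(1) by (simp add: good_def)
        ultimately show ?thesis using P(2) notin by simp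
      qed
      then have "V s \<le> V q - dist (f s) (f q)"
        unfolding V_def[of s] using good_empty by (intro cSup_least) (auto simp: vs_def)
      then show ?thesis by simp
    qed
    \<comment> \<open>The linear term pays for increments starting outside \<open>N\<close>, the
      term \<open>V\<close> for those starting in \<open>N\<close>, where no difference quotient is
      available.\<close>
    define g where "g s = (K + e) * (s - a) + V s" for s
    have "V a \<ge> 0"
      unfolding V_def using bdd[OF ab] good_empty
      by (intro cSup_upper2[of 0]) (force simp: vs_def image_iff)+
    have "f b - f a \<le> g b"
    proof (rule real_interval_induct[OF ab])
      show "f a - f a \<le> g a" using \<open>V a \<ge> 0\<close> by (simp add: g_def)
    next
      fix c assume "a < c" "c \<le> b" and below: "\<And>r. a \<le> r \<Longrightarrow> r < c \<Longrightarrow> f r - f a \<le> g r"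
      have "continuous_on {a..c} f"
        using absolutely_continuous_curve_imp_continuous[OF ac] \<open>c \<le> b\<close>
        by (auto intro: continuous_on_subset)
      then have "(f \<longlongrightarrow> f c) (at_left c)"
        using \<open>a < c\<close> by (auto simp: continuous_on_Icc_at_leftD)
      \<comment> \<open>\<open>V\<close> may jump, so \<open>V r\<close> is replaced by the larger
        constant \<open>V c\<close> before passing to the limit.\<close>
      moreover have "((\<lambda>r. (K + e) * (r - a) + V c) \<longlongrightarrow> g c) (at_left c)"
        unfolding g_def by (intro tendsto_intros)
      moreover have "\<forall>\<^sub>F r in at_left c. f r - f a \<le> (K + e) * (r - a) + V c"
        unfolding eventually_at_left_field
      proof (intro exI[of _ a] conjI allI impI)
        fix r assume "a < r" "r < c"
        then show "f r - f a \<le> (K + e) * (r - a) + V c"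
          using below[of r] V_mono[of r c] \<open>c \<le> b\<close> by (simp add: g_def)
      qed fact
      ultimately show "f c - f a \<le> g c"
        by (intro tendsto_le[of "at_left c" _ "g c" "\<lambda>r. f r - f a" "f c - f a"])
           (auto intro!: tendsto_intros)
    next
      fix c assume ac_le: "a \<le> c" and "c < b" and upto: "\<And>r. a \<le> r \<Longrightarrow> r \<le> c \<Longrightarrow> f r - f a \<le> g r"
      have "\<exists>h0>0. \<forall>h. 0 < h \<and> h < h0 \<longrightarrow> f (c + h) - f c \<le> g (c + h) - g c"
      proof (cases "c \<in> N")
        case True
        then obtain r where r: "r > 0" "ball c r \<subseteq> U"
          using U(1,2) by (meson open_contains_ball subsetD)
        show ?thesis
        proof (intro exI[of _ "min r (b - c)"] conjI allI impI)
          fix h assume h: "0 < h \<and> h < min r (b - c)"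
          then have "{c..c + h} \<subseteq> U" using r(2) by (auto simp: dist_real_def subset_iff)
          then have V1: "V c + dist (f c) (f (c + h)) \<le> V (c + h)"
            using V_step[of c "c + h"] h ac_le by auto
          then show "f (c + h) - f c \<le> g (c + h) - g c"
          proof -
            have "0 \<le> (K + e) * h" using h K e by simp
            moreover have "g (c + h) - g c = (K + e) * h + V (c + h) - V c"
              by (simp add: g_def algebra_simps)
            ultimately show ?thesis using V1 by (simp add: dist_real_def)
          qed
        qed (use r \<open>c < b\<close> in auto)
      next
        case False
        then obtain d' where d': "d' > 0" "\<And>h. 0 < h \<and> h < d' \<Longrightarrow> f (c + h) - f c \<le> (K + e) * h"
          using D[of c e] ac_le \<open>c < b\<close> e by auto
        show ?thesis
        proof (intro exI[of _ "min d' (b - c)"] conjI allI impI)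
          fix h assume h: "0 < h \<and> h < min d' (b - c)"
          then have "f (c + h) - f c \<le> (K + e) * h" "V c \<le> V (c + h)"
            using d'(2)[of h] V_mono[of c "c + h"] by auto
          then show "f (c + h) - f c \<le> g (c + h) - g c"
            by (simp add: g_def algebra_simps)
        qed (use d' \<open>c < b\<close> in auto)
      qed
      then obtain h0 where h0: "h0 > 0"
        "\<And>h. 0 < h \<and> h < h0 \<Longrightarrow> f (c + h) - f c \<le> g (c + h) - g c" by blast
      have "f r - f a \<le> g r" if "c < r" "r < c + h0" for r
        using upto[of c] ac_le h0(2)[of "r - c"] that by auto
      then show "\<exists>d>0. \<forall>r. c < r \<and> r < c + d \<longrightarrow> f r - f a \<le> g r"
        using h0(1) by blast
    qed
    then show ?thesis using Ve[of b] by (simp add: g_def)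
  qed
  have "f b - f a \<le> K * (b - a) + e" if "e > 0" for e
  proof -
    \<comment> \<open>The two errors \<open>e' * (b - a)\<close> and \<open>e'\<close> add up to
      \<open>e\<close>.\<close>
    define e' where "e' = e / (b - a + 1)"
    have "e' > 0" "e' * (b - a + 1) = e" using that ab by (auto simp: e'_def)
    then show ?thesis using main[of e'] by (simp add: algebra_simps)
  qed
  then show ?thesis by (rule field_le_epsilon)
qed

section \<open>Outer normals and invariance of closed sets along curves\<close>

text \<open>The last clause says that the open ball with centre \<open>y + \<nu>\<close> and radius \<open>norm \<nu>\<close> misses \<open>F\<close> near \<open>y\<close>.\<close>

definition outer_normal :: "'a::real_inner set \<Rightarrow> 'a \<Rightarrow> 'a \<Rightarrow> bool" where
  "outer_normal F y \<nu> \<longleftrightarrow>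
     y \<in> F \<and> (\<exists>r>0. \<forall>z\<in>ball y r. (norm (z - y))\<^sup>2 < 2 * (\<nu> \<bullet> (z - y)) \<longrightarrow> z \<notin> F)"

lemma absolutely_continuous_curve_subinterval:
  assumes "absolutely_continuous_curve a b f" "a \<le> a'" "b' \<le> b"
  shows "absolutely_continuous_curve a' b' f"
  unfolding absolutely_continuous_curve_def
proof (intro allI impI)
  fix e :: real assume "e > 0"
  then obtain d where d: "d > 0" and *: "\<And>P. finite P \<and> (\<forall>(p, q)\<in>P. a \<le> p \<and> p \<le> q \<and> q \<le> b) \<and>
        pairwise (\<lambda>I J. disjnt {fst I<..<snd I} {fst J<..<snd J}) P \<and>
        (\<Sum>(p, q)\<in>P. q - p) < d \<Longrightarrow> (\<Sum>(p, q)\<in>P. dist (f p) (f q)) < e"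
    using assms unfolding absolutely_continuous_curve_def by meson
  show "\<exists>d>0. \<forall>P. finite P \<and> (\<forall>(p, q)\<in>P. a' \<le> p \<and> p \<le> q \<and> q \<le> b') \<and>
        pairwise (\<lambda>I J. disjnt {fst I<..<snd I} {fst J<..<snd J}) P \<and>
        (\<Sum>(p, q)\<in>P. q - p) < d \<longrightarrow> (\<Sum>(p, q)\<in>P. dist (f p) (f q)) < e"
  proof (intro exI[of _ d] conjI allI impI)
    fix P :: "(real \<times> real) set"
    assume P: "finite P \<and> (\<forall>(p, q)\<in>P. a' \<le> p \<and> p \<le> q \<and> q \<le> b') \<and>
        pairwise (\<lambda>I J. disjnt {fst I<..<snd I} {fst J<..<snd J}) P \<and> (\<Sum>(p, q)\<in>P. q - p) < d"
    then have "\<forall>(p, q)\<in>P. a \<le> p \<and> p \<le> q \<and> q \<le> b" using assms(2,3) by fastforce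
    then show "(\<Sum>(p, q)\<in>P. dist (f p) (f q)) < e" using P by (intro *) auto
  qed fact
qed

lemma absolutely_continuous_curve_lipschitz_compose:
  assumes ac: "absolutely_continuous_curve a b f" and L: "0 \<le> L"
    and le: "\<And>p q. p \<in> {a..b} \<Longrightarrow> q \<in> {a..b} \<Longrightarrow> dist (g p) (g q) \<le> L * dist (f p) (f q)"
  shows "absolutely_continuous_curve a b g"
  unfolding absolutely_continuous_curve_def
proof (intro allI impI)
  fix e :: real assume e: "e > 0"
  then have "e / (L + 1) > 0" using L by simp
  then obtain d where d: "d > 0" and *: "\<And>P. finite P \<and> (\<forall>(p, q)\<in>P. a \<le> p \<and> p \<le> q \<and> q \<le> b) \<and>
        pairwise (\<lambda>I J. disjnt {fst I<..<snd I} {fst J<..<snd J}) P \<and>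
        (\<Sum>(p, q)\<in>P. q - p) < d \<Longrightarrow> (\<Sum>(p, q)\<in>P. dist (f p) (f q)) < e / (L + 1)"
    using ac unfolding absolutely_continuous_curve_def by meson
  show "\<exists>d>0. \<forall>P. finite P \<and> (\<forall>(p, q)\<in>P. a \<le> p \<and> p \<le> q \<and> q \<le> b) \<and>
        pairwise (\<lambda>I J. disjnt {fst I<..<snd I} {fst J<..<snd J}) P \<and>
        (\<Sum>(p, q)\<in>P. q - p) < d \<longrightarrow> (\<Sum>(p, q)\<in>P. dist (g p) (g q)) < e"
  proof (intro exI[of _ d] conjI allI impI)
    fix P :: "(real \<times> real) set"
    assume P: "finite P \<and> (\<forall>(p, q)\<in>P. a \<le> p \<and> p \<le> q \<and> q \<le> b) \<and>
        pairwise (\<lambda>I J. disjnt {fst I<..<snd I} {fst J<..<snd J}) P \<and> (\<Sum>(p, q)\<in>P. q - p) < d"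
    have "(\<Sum>(p, q)\<in>P. dist (g p) (g q)) \<le> (\<Sum>(p, q)\<in>P. L * dist (f p) (f q))"
      using P by (intro sum_mono) (auto intro!: le)
    also have "\<dots> = L * (\<Sum>(p, q)\<in>P. dist (f p) (f q))"
      by (simp add: sum_distrib_left case_prod_beta)
    also have "\<dots> \<le> L * (e / (L + 1))"
      using *[of P] P L by (intro mult_left_mono) auto
    also have "\<dots> < e" using e L by (simp add: field_simps)
    finally show "(\<Sum>(p, q)\<in>P. dist (g p) (g q)) < e" .
  qed fact
qed

lemma absolutely_continuous_curve_id: "absolutely_continuous_curve a b (\<lambda>s::real. s)"
  unfolding absolutely_continuous_curve_def
proof (intro allI impI)
  fix e :: real assume "e > 0"
  moreover have "(\<Sum>(p, q)\<in>P. dist p q) = (\<Sum>(p, q)\<in>P. q - p)"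
    if "\<forall>(p, q)\<in>P. a \<le> p \<and> p \<le> q \<and> q \<le> b" for P
    using that by (intro sum.cong refl) (auto simp: dist_real_def)
  ultimately show "\<exists>d>0. \<forall>P. finite P \<and> (\<forall>(p, q)\<in>P. a \<le> p \<and> p \<le> q \<and> q \<le> b) \<and>
        pairwise (\<lambda>I J. disjnt {fst I<..<snd I} {fst J<..<snd J}) P \<and>
        (\<Sum>(p, q)\<in>P. q - p) < d \<longrightarrow> (\<Sum>(p, q)\<in>P. dist p q) < e"
    by (intro exI[of _ e]) auto
qed

lemma absolutely_continuous_curve_line:
  "absolutely_continuous_curve a b (\<lambda>s. z + s *\<^sub>R (v :: 'a::real_normed_vector))"
  by (rule absolutely_continuous_curve_lipschitz_compose
        [OF absolutely_continuous_curve_id norm_ge_zero[of v]])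
     (simp add: dist_norm dist_real_def mult.commute flip: scaleR_left_diff_distrib)

text \<open>With \<nu> = \<open>p - y\<close> the inequality in \<open>outer_normal\<close> says
  exactly that \<open>z\<close> is closer to \<open>p\<close> than \<open>y\<close> is, as expanding
  the square of \<open>p - z\<close> shows.\<close>

lemma outer_normal_of_nearest_point:
  assumes "y \<in> F" and r: "r > 0" and near: "\<And>z. z \<in> F \<Longrightarrow> dist p z < dist p y \<Longrightarrow> z \<notin> ball y r"
  shows "outer_normal F y (p - y)"
  unfolding outer_normal_def
proof (intro conjI exI[of _ r] ballI impI notI)
  fix z assume z: "z \<in> ball y r" "(norm (z - y))\<^sup>2 < 2 * ((p - y) \<bullet> (z - y))" "z \<in> F"
  have "(norm (p - z))\<^sup>2 = (norm (p - y))\<^sup>2 + (norm (z - y))\<^sup>2 - 2 * ((p - y) \<bullet> (z - y))"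
    unfolding power2_norm_eq_inner by (simp add: inner_diff_left inner_diff_right inner_commute)
  then have "(norm (p - z))\<^sup>2 < (norm (p - y))\<^sup>2" using z(2) by linarith
  then have "norm (p - z) < norm (p - y)" by (rule power2_less_imp_less) simp
  then show False using near[of z] z by (simp add: dist_norm)
qed fact+

text \<open>
  Nagumo's argument: the squared distance \<open>\<phi>\<close> to \<open>F\<close> along the curve is absolutely continuous
  and satisfies \<open>\<phi>' \<le> 2 C \<phi>\<close> almost everywhere.
\<close>

lemma invariant_along_curve_local:
  fixes \<gamma> :: "real \<Rightarrow> 'a::euclidean_space"
  assumes "open \<Omega>" and F: "closedin (top_of_set \<Omega>) F"
    and ac: "absolutely_continuous_curve a b \<gamma>" and "a < b" and Fa: "\<gamma> a \<in> F"
    and C: "0 \<le> C" and N: "negligible N"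
    and D: "\<And>s. s \<in> {a..b} - N \<Longrightarrow> \<exists>v. (\<gamma> has_vector_derivative v) (at s within {a..b}) \<and>
              (\<forall>y. outer_normal F y (\<gamma> s - y) \<longrightarrow> (\<gamma> s - y) \<bullet> v \<le> C * (norm (\<gamma> s - y))\<^sup>2)"
  shows "\<exists>d>0. \<forall>s. a < s \<and> s < a + d \<and> s \<le> b \<longrightarrow> \<gamma> s \<in> F"
proof -
  obtain T where T: "closed T" "F = \<Omega> \<inter> T" using F by (auto simp: closedin_closed)
  then have "\<gamma> a \<in> \<Omega>" using Fa by auto
  then obtain r where r: "r > 0" "cball (\<gamma> a) r \<subseteq> \<Omega>"
    using \<open>open \<Omega>\<close> by (meson open_contains_cball)
  \<comment> \<open>\<open>F\<close> is closed only relative to \<Omega>; cutting with a closed ball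
    inside \<Omega> gives a closed set, so that distances are attained.\<close>
  define A where "A = F \<inter> cball (\<gamma> a) r"
  have "A = T \<inter> cball (\<gamma> a) r" using T r by (auto simp: A_def)
  then have "closed A" using T by (simp add: closed_Int)
  have "\<gamma> a \<in> A" using Fa r by (simp add: A_def)
  then have "A \<noteq> {}" by blast
  have cont: "continuous_on {a..b} \<gamma>" by (rule absolutely_continuous_curve_imp_continuous[OF ac])
  then obtain d0 where d0: "d0 > 0" "\<And>s. s \<in> {a..b} \<Longrightarrow> dist s a < d0 \<Longrightarrow> dist (\<gamma> s) (\<gamma> a) < r / 2"
    using r(1) \<open>a < b\<close> unfolding continuous_on_iff by (metis atLeastAtMost_iff half_gt_zero less_imp_le order_refl)
  \<comment> \<open>Keeps the curve within \<open>r / 2\<close> of its start and the parameter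
    within \<open>{a..b}\<close>, and makes \<open>2 * C * d < 1\<close>.\<close>
  define d where "d = Min {d0 / 2, b - a, 1 / (4 * C + 4)}"
  have d: "d > 0" "d < d0" "d \<le> b - a" "2 * C * d < 1"
  proof -
    show "d > 0" "d < d0" "d \<le> b - a" using d0(1) \<open>a < b\<close> C by (auto simp: d_def min_def)
    have "2 * C * d \<le> 2 * C * (1 / (4 * C + 4))"
      using C by (intro mult_left_mono) (auto simp: d_def)
    also have "\<dots> < 1" using C by (simp add: field_simps)
    finally show "2 * C * d < 1" .
  qed
  define I where "I = {a..a + d}"
  have I: "I \<subseteq> {a..b}" "compact I" "a \<in> I" using d by (auto simp: I_def)
  have near: "dist (\<gamma> s) (\<gamma> a) < r / 2" if "s \<in> I" for s
    using that d by (intro d0(2)) (auto simp: I_def dist_real_def)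
  define \<phi> where "\<phi> s = (infdist (\<gamma> s) A)\<^sup>2" for s
  have inf_le: "infdist (\<gamma> s) A \<le> r / 2" if "s \<in> I" for s
    using infdist_le[OF \<open>\<gamma> a \<in> A\<close>, of "\<gamma> s"] near[OF that] by simp
  have acI: "absolutely_continuous_curve a (a + d) \<gamma>"
    using ac by (rule absolutely_continuous_curve_subinterval) (use d in auto)
  have ac\<phi>: "absolutely_continuous_curve a (a + d) \<phi>"
  proof (rule absolutely_continuous_curve_lipschitz_compose[OF acI])
    show "0 \<le> r" using r by simp
    fix p q assume pq: "p \<in> {a..a + d}" "q \<in> {a..a + d}"
    have "dist (\<phi> p) (\<phi> q) = \<bar>infdist (\<gamma> p) A + infdist (\<gamma> q) A\<bar> * \<bar>infdist (\<gamma> p) A - infdist (\<gamma> q) A\<bar>"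
      by (simp add: \<phi>_def dist_real_def power2_eq_square algebra_simps flip: abs_mult)
    also have "\<dots> \<le> r * dist (\<gamma> p) (\<gamma> q)"
    proof (rule mult_mono)
      show "\<bar>infdist (\<gamma> p) A + infdist (\<gamma> q) A\<bar> \<le> r"
        using inf_le[of p] inf_le[of q] pq infdist_nonneg[of "\<gamma> p" A] infdist_nonneg[of "\<gamma> q" A]
        by (auto simp: I_def)
      show "\<bar>infdist (\<gamma> p) A - infdist (\<gamma> q) A\<bar> \<le> dist (\<gamma> p) (\<gamma> q)"
        using infdist_triangle[of "\<gamma> p" A "\<gamma> q"] infdist_triangle[of "\<gamma> q" A "\<gamma> p"]
        by (auto simp: dist_commute)
    qed (use r in auto)
    finally show "dist (\<phi> p) (\<phi> q) \<le> r * dist (\<gamma> p) (\<gamma> q)" .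
  qed
  have "continuous_on I \<phi>" unfolding I_def by (rule absolutely_continuous_curve_imp_continuous[OF ac\<phi>])
  then obtain s0 where s0: "s0 \<in> I" "\<And>s. s \<in> I \<Longrightarrow> \<phi> s \<le> \<phi> s0"
    using continuous_attains_sup[of I \<phi>] I by blast
  \<comment> \<open>Gronwall in its simplest form: at the maximum point \<open>s0\<close> the factor
    \<phi> in the differential inequality is replaced by the constant \<open>\<phi> s0\<close>, and
    \<open>2 * C * d < 1\<close> then forces \<open>\<phi> s0 \<le> 0\<close>.\<close>
  have "\<phi> s0 - \<phi> a \<le> 2 * C * \<phi> s0 * (s0 - a)"
  proof (rule absolutely_continuous_growth_bound[OF _ _ N])
    show "absolutely_continuous_curve a s0 \<phi>"
      using ac\<phi> by (rule absolutely_continuous_curve_subinterval) (use s0 in \<open>auto simp: I_def\<close>)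
    show "a \<le> s0" "0 \<le> 2 * C * \<phi> s0" using s0 C by (auto simp: I_def \<phi>_def)
    fix s e :: real assume s: "s \<in> {a..<s0} - N" and "e > 0"
    have sI: "s \<in> I" "s < b" using s s0(1) d by (auto simp: I_def)
    obtain v where v: "(\<gamma> has_vector_derivative v) (at s within {a..b})"
        "\<And>y. outer_normal F y (\<gamma> s - y) \<Longrightarrow> (\<gamma> s - y) \<bullet> v \<le> C * (norm (\<gamma> s - y))\<^sup>2"
      using D[of s] s sI I by blast
    obtain y where y: "y \<in> A" "infdist (\<gamma> s) A = dist (\<gamma> s) y"
      using infdist_attains_inf[OF \<open>closed A\<close> \<open>A \<noteq> {}\<close>] by metis
    have "outer_normal F y (\<gamma> s - y)"
    proof (rule outer_normal_of_nearest_point[of _ _ 1])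
      show "y \<in> F" using y by (simp add: A_def)
      \<comment> \<open>A point of \<open>F\<close> closer to \<open>\<gamma> s\<close> than
        \<open>y\<close> would lie within \<open>r / 2 + r / 2\<close> of \<open>\<gamma> a\<close>,
        hence in \<open>A\<close>. So \<open>y\<close> is nearest in \<open>F\<close> and not only
        in \<open>A\<close>; the radius 1 is arbitrary.\<close>
      fix z assume z: "z \<in> F" "dist (\<gamma> s) z < dist (\<gamma> s) y"
      then have "dist (\<gamma> a) z \<le> r"
        using near[OF sI(1)] inf_le[OF sI(1)] y dist_triangle[of "\<gamma> a" z "\<gamma> s"]
        by (simp add: dist_commute)
      then have "z \<in> A" using z by (simp add: A_def)
      then show "z \<notin> ball y 1" using infdist_le[of z A "\<gamma> s"] z y by simp
    qed simp
    then have vb: "(\<gamma> s - y) \<bullet> v \<le> C * \<phi> s"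
      using v(2) y by (simp add: \<phi>_def dist_norm)
    \<comment> \<open>The distance function need not be differentiable. Freezing the nearest point
      gives a smooth majorant along the curve that agrees with \<phi> at \<open>s\<close>, and its
      derivative bounds the right difference quotients of \<phi>.\<close>
    define \<psi> where "\<psi> q = (\<gamma> q - y) \<bullet> (\<gamma> q - y)" for q
    have "(\<psi> has_real_derivative 2 * ((\<gamma> s - y) \<bullet> v)) (at s within {a..b})"
      unfolding \<psi>_def has_field_derivative_def
      by (rule has_derivative_eq_rhs,
          (rule derivative_intros v(1)[unfolded has_vector_derivative_def])+)
         (auto simp: inner_commute algebra_simps)
    then have "((\<lambda>q. (\<psi> q - \<psi> s) / (q - s)) \<longlongrightarrow> 2 * ((\<gamma> s - y) \<bullet> v)) (at s within {a..b})"
      by (simp add: has_field_derivative_iff)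
    moreover have "2 * ((\<gamma> s - y) \<bullet> v) < 2 * C * \<phi> s0 + e"
      using vb s0(2)[OF sI(1)] C \<open>e > 0\<close> mult_left_mono[of "\<phi> s" "\<phi> s0" C] by linarith
    ultimately have "\<forall>\<^sub>F q in at s within {a..b}. (\<psi> q - \<psi> s) / (q - s) < 2 * C * \<phi> s0 + e"
      by (rule order_tendstoD(2))
    then obtain d1 where d1: "d1 > 0"
      "\<And>q. q \<in> {a..b} \<Longrightarrow> q \<noteq> s \<Longrightarrow> dist q s < d1 \<Longrightarrow> (\<psi> q - \<psi> s) / (q - s) < 2 * C * \<phi> s0 + e"
      unfolding eventually_at by blast
    show "\<exists>d>0. \<forall>h. 0 < h \<and> h < d \<longrightarrow> \<phi> (s + h) - \<phi> s \<le> (2 * C * \<phi> s0 + e) * h"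
    proof (intro exI[of _ "min d1 (b - s)"] conjI allI impI)
      fix h assume h: "0 < h \<and> h < min d1 (b - s)"
      have "\<phi> (s + h) \<le> \<psi> (s + h)"
        using infdist_le[OF y(1), of "\<gamma> (s + h)"]
        by (auto simp: \<phi>_def \<psi>_def dist_norm power2_norm_eq_inner[symmetric] intro!: power_mono infdist_nonneg)
      moreover have "\<phi> s = \<psi> s"
        using y by (simp add: \<phi>_def \<psi>_def dist_norm power2_norm_eq_inner)
      moreover have "(\<psi> (s + h) - \<psi> s) / (s + h - s) < 2 * C * \<phi> s0 + e"
        using h s sI by (intro d1(2)) (auto simp: dist_real_def)
      then have "\<psi> (s + h) - \<psi> s \<le> (2 * C * \<phi> s0 + e) * h"
        using h by (simp add: field_simps)
      ultimately show "\<phi> (s + h) - \<phi> s \<le> (2 * C * \<phi> s0 + e) * h" by linarith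
    qed (use d1 sI in auto)
  qed
  moreover have "\<phi> a = 0" using \<open>\<gamma> a \<in> A\<close> by (simp add: \<phi>_def)
  moreover have "2 * C * \<phi> s0 * (s0 - a) \<le> 2 * C * \<phi> s0 * d"
    using s0(1) C by (intro mult_left_mono) (auto simp: I_def \<phi>_def)
  ultimately have "\<phi> s0 * (1 - 2 * C * d) \<le> 0" by (simp add: algebra_simps)
  then have "\<phi> s0 \<le> 0" using d(4) by (auto simp: mult_le_0_iff)
  have "\<gamma> s \<in> F" if "s \<in> I" for s
  proof -
    have "\<phi> s \<le> 0" using s0(2)[OF that] \<open>\<phi> s0 \<le> 0\<close> by simp
    then have "infdist (\<gamma> s) A = 0" by (simp add: \<phi>_def)
    then have "\<gamma> s \<in> A" using \<open>closed A\<close> \<open>A \<noteq> {}\<close> by (simp add: in_closed_iff_infdist_zero)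
    then show ?thesis by (simp add: A_def)
  qed
  then show ?thesis using d(1) by (intro exI[of _ d]) (auto simp: I_def)
qed

text \<open>Real induction: the local lemma, restarted at the parameter reached so far, gives
  \<open>step\<close>; relative closedness of \<open>F\<close> together with
  \<open>\<gamma> c \<in> \<Omega>\<close> gives \<open>limit\<close>.\<close>

lemma invariant_along_curve:
  fixes \<gamma> :: "real \<Rightarrow> 'a::euclidean_space"
  assumes "open \<Omega>" and F: "closedin (top_of_set \<Omega>) F"
    and ac: "absolutely_continuous_curve a b \<gamma>" and "a \<le> b" and "\<gamma> ` {a..b} \<subseteq> \<Omega>" and "\<gamma> a \<in> F"
    and C: "0 \<le> C" and N: "negligible N"
    and D: "\<And>s. s \<in> {a..b} - N \<Longrightarrow> \<exists>v. (\<gamma> has_vector_derivative v) (at s within {a..b}) \<and>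
              (\<forall>y. outer_normal F y (\<gamma> s - y) \<longrightarrow> (\<gamma> s - y) \<bullet> v \<le> C * (norm (\<gamma> s - y))\<^sup>2)"
  shows "\<gamma> b \<in> F"
  using \<open>a \<le> b\<close>
proof (induction rule: real_interval_induct)
  case start
  then show ?case by fact
next
  case (limit c)
  obtain T where T: "closed T" "F = \<Omega> \<inter> T" using F by (auto simp: closedin_closed)
  have "continuous_on {a..c} \<gamma>"
    using absolutely_continuous_curve_imp_continuous[OF ac] limit(2)
    by (auto intro: continuous_on_subset)
  then have "(\<gamma> \<longlongrightarrow> \<gamma> c) (at_left c)" using limit(1) by (auto simp: continuous_on_Icc_at_leftD)
  moreover have "\<forall>\<^sub>F r in at_left c. \<gamma> r \<in> T"
    unfolding eventually_at_left_field using limit(1,3) T(2) by (intro exI[of _ a]) auto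
  ultimately have "\<gamma> c \<in> T" using Lim_in_closed_set[OF T(1)] by (metis trivial_limit_at_left_real)
  then show ?case using T(2) assms(5) limit(1,2) by auto
next
  case (step c)
  have "\<exists>d>0. \<forall>s. c < s \<and> s < c + d \<and> s \<le> b \<longrightarrow> \<gamma> s \<in> F"
  proof (rule invariant_along_curve_local[OF assms(1) F _ step(2) _ C N])
    show "absolutely_continuous_curve c b \<gamma>"
      using ac by (rule absolutely_continuous_curve_subinterval) (use step in auto)
    show "\<gamma> c \<in> F" using step by auto
    fix s assume "s \<in> {c..b} - N"
    then show "\<exists>v. (\<gamma> has_vector_derivative v) (at s within {c..b}) \<and>
              (\<forall>y. outer_normal F y (\<gamma> s - y) \<longrightarrow> (\<gamma> s - y) \<bullet> v \<le> C * (norm (\<gamma> s - y))\<^sup>2)"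
      using D[of s] step(1) has_vector_derivative_within_subset[of \<gamma> _ s "{a..b}" "{c..b}"] by fastforce
  qed
  then obtain d where "d > 0" "\<And>s. c < s \<and> s < c + d \<and> s \<le> b \<Longrightarrow> \<gamma> s \<in> F" by blast
  then show ?case using step(2) 
    by (intro exI[of _ "min d (b - c)"] conjI allI impI) (auto simp: min_def split: if_splits)
qed

section \<open>The matrix exponential and the flow of Y\<close>

lemma bounded_bilinear_matrix_matrix_mult:
  "bounded_bilinear ((**) :: 'n::finite sqmat \<Rightarrow> 'n sqmat \<Rightarrow> 'n sqmat)"
  unfolding bilinear_conv_bounded_bilinear[symmetric] bilinear_def linear_iff
  by (auto simp: vec_eq_iff matrix_matrix_mult_def sum.distrib sum_distrib_left algebra_simps)

lemma bounded_bilinear_matrix_vector_mult: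
  "bounded_bilinear ((*v) :: 'n::finite sqmat \<Rightarrow> real^'n \<Rightarrow> real^'n)"
  unfolding bilinear_conv_bounded_bilinear[symmetric] bilinear_def linear_iff
  by (auto simp: vec_eq_iff matrix_vector_mult_def sum.distrib sum_distrib_left algebra_simps)

lemma mat_pow_scaleR: "mat_pow (c *\<^sub>R A) k = c ^ k *\<^sub>R mat_pow A k"
  by (induction k)
     (simp_all add: bounded_bilinear.scaleR_left[OF bounded_bilinear_matrix_matrix_mult]
        bounded_bilinear.scaleR_right[OF bounded_bilinear_matrix_matrix_mult])

lemma mat_pow_commute: "A ** mat_pow A k = mat_pow A k ** A"
  by (induction k) (simp_all add: matrix_mul_assoc)

text \<open>A geometric bound, so that each entry of the exponential series is dominated by a scalar
  exponential series.\<close>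

lemma mat_pow_entry_bound:
  fixes A :: "'n::finite sqmat"
  shows "\<bar>mat_pow A k $ i $ j\<bar> \<le> (1 + (\<Sum>i\<in>UNIV. \<Sum>j\<in>UNIV. \<bar>A $ i $ j\<bar>)) ^ k"
proof (induction k arbitrary: i)
  case 0
  then show ?case by (simp add: mat_def)
next
  case (Suc k)
  let ?C = "1 + (\<Sum>i\<in>UNIV. \<Sum>j\<in>UNIV. \<bar>A $ i $ j\<bar>)"
  have "?C \<ge> 0" by (intro add_nonneg_nonneg sum_nonneg) auto
  have "\<bar>mat_pow A (Suc k) $ i $ j\<bar> \<le> (\<Sum>l\<in>UNIV. \<bar>A $ i $ l\<bar> * \<bar>mat_pow A k $ l $ j\<bar>)"
    by (simp add: matrix_matrix_mult_def abs_mult[symmetric] sum_abs)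
  also have "\<dots> \<le> (\<Sum>l\<in>UNIV. \<bar>A $ i $ l\<bar> * ?C ^ k)"
    by (intro sum_mono mult_left_mono Suc.IH) auto
  also have "\<dots> = (\<Sum>l\<in>UNIV. \<bar>A $ i $ l\<bar>) * ?C ^ k" by (simp add: sum_distrib_right)
  also have "\<dots> \<le> ?C * ?C ^ k"
  proof (rule mult_right_mono)
    have "(\<Sum>l\<in>UNIV. \<bar>A $ i $ l\<bar>) \<le> (\<Sum>i\<in>UNIV. \<Sum>j\<in>UNIV. \<bar>A $ i $ j\<bar>)"
      by (rule member_le_sum[of i UNIV "\<lambda>i. \<Sum>j\<in>UNIV. \<bar>A $ i $ j\<bar>"]) (auto intro: sum_nonneg)
    then show "(\<Sum>l\<in>UNIV. \<bar>A $ i $ l\<bar>) \<le> ?C" by simp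
  qed (use \<open>?C \<ge> 0\<close> in simp)
  finally show ?case by simp
qed

lemma exp_entry_summable: "summable (\<lambda>k. mat_pow B k $ i $ j / fact k * (s::real) ^ k)"
proof (rule summable_comparison_test')
  define C where "C = 1 + (\<Sum>i\<in>UNIV. \<Sum>j\<in>UNIV. \<bar>B $ i $ j\<bar>)"
  show "summable (\<lambda>k. inverse (fact k) * (C * \<bar>s\<bar>) ^ k)" by (rule summable_exp)
  fix k :: nat
  have "\<bar>mat_pow B k $ i $ j\<bar> * \<bar>s\<bar> ^ k / fact k \<le> C ^ k * \<bar>s\<bar> ^ k / fact k"
    unfolding C_def by (intro divide_right_mono mult_right_mono mat_pow_entry_bound) auto
  then show "norm (mat_pow B k $ i $ j / fact k * s ^ k) \<le> inverse (fact k) * (C * \<bar>s\<bar>) ^ k"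
    by (simp add: abs_mult power_abs power_mult_distrib divide_inverse mult_ac)
qed

text \<open>\<open>mat_exp\<close> is a \<open>suminf\<close> and carries no information before
  convergence is known; convergence is checked entry by entry.\<close>

lemma mat_exp_sums:
  "(\<lambda>k. (1 / fact k) *\<^sub>R mat_pow (s *\<^sub>R B) k) sums mat_exp (s *\<^sub>R B)"
proof -
  have "(\<lambda>k. (1 / fact k) *\<^sub>R mat_pow (s *\<^sub>R B) k) sums
        (\<chi> i j. \<Sum>k. mat_pow B k $ i $ j / fact k * s ^ k)"
    unfolding sums_def
  proof (intro vec_tendstoI)
    fix i j
    have "(\<lambda>n. \<Sum>k<n. mat_pow B k $ i $ j / fact k * s ^ k)
        \<longlonglongrightarrow> (\<Sum>k. mat_pow B k $ i $ j / fact k * s ^ k)"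
      using exp_entry_summable by (rule summable_LIMSEQ)
    then show "(\<lambda>n. (\<Sum>k<n. (1 / fact k) *\<^sub>R mat_pow (s *\<^sub>R B) k) $ i $ j)
        \<longlonglongrightarrow> (\<chi> i j. \<Sum>k. mat_pow B k $ i $ j / fact k * s ^ k) $ i $ j"
      by (simp add: mat_pow_scaleR mult.commute)
  qed
  then show ?thesis unfolding mat_exp_def by (rule summable_sums[OF sums_summable])
qed

text \<open>With the sign reversed, \<open>E_mat\<close> is exp(s B), the flow of the drift. As
  power series in \<open>s\<close>, its entries can be differentiated term by term.\<close>

lemma E_mat_entry: "E_mat B (- s) $ i $ j = (\<Sum>k. mat_pow B k $ i $ j / fact k * s ^ k)"
proof -
  have "bounded_linear (\<lambda>A::'a sqmat. A $ i $ j)"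
    by (intro bounded_linear_compose[OF bounded_linear_vec_nth] bounded_linear_vec_nth)
  then have "(\<lambda>k. ((1 / fact k) *\<^sub>R mat_pow (s *\<^sub>R B) k) $ i $ j) sums (mat_exp (s *\<^sub>R B) $ i $ j)"
    by (rule bounded_linear.sums[OF _ mat_exp_sums])
  then show ?thesis by (simp add: E_mat_def mat_pow_scaleR sums_iff mult.commute)
qed

lemma E_mat_commute: "B ** E_mat B s = E_mat B s ** B"
proof -
  define c where "c = - s"
  let ?f = "\<lambda>k. (1 / fact k) *\<^sub>R mat_pow (c *\<^sub>R B) k"
  note bb = bounded_bilinear_matrix_matrix_mult
  have "B ** ?f k = ?f k ** B" for k
    by (simp add: mat_pow_scaleR mat_pow_commute bounded_bilinear.scaleR_left[OF bb]
        bounded_bilinear.scaleR_right[OF bb])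
  moreover have "(\<lambda>k. B ** ?f k) sums (B ** E_mat B s)" "(\<lambda>k. ?f k ** B) sums (E_mat B s ** B)"
    unfolding E_mat_def c_def[symmetric]
    using bounded_linear.sums[OF bounded_bilinear.bounded_linear_right[OF bb] mat_exp_sums[of c B]]
      bounded_linear.sums[OF bounded_bilinear.bounded_linear_left[OF bb] mat_exp_sums[of c B]] by auto
  ultimately show ?thesis by (simp add: sums_unique2)
qed

lemma E_mat_0 [simp]: "E_mat B 0 = mat 1"
proof -
  have "E_mat B (- 0) $ i $ j = mat 1 $ i $ j" for i j
    unfolding E_mat_entry powser_zero by simp
  then show ?thesis by (simp add: vec_eq_iff)
qed

text \<open>Works entry by entry: \<open>diffs\<close> cancels one factor of the factorial and
  leaves \<open>mat_pow B (Suc k)\<close>, whose leading factor \<open>B\<close> is then pulled out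
  of the series.\<close>

lemma flow_has_vector_derivative:
  "((\<lambda>s. E_mat B (- s)) has_vector_derivative (B ** E_mat B (- s))) (at s)"
proof -
  have "((\<lambda>r. E_mat B (- r) $ i $ j) has_real_derivative (B ** E_mat B (- s)) $ i $ j) (at s)" for i j
  proof -
    let ?c = "\<lambda>i k. mat_pow B k $ i $ j / fact k"
    have "((\<lambda>r. \<Sum>k. ?c i k * r ^ k) has_field_derivative (\<Sum>k. diffs (?c i) k * s ^ k)) (at s)"
      by (rule termdiffs_strong_converges_everywhere) (rule exp_entry_summable)
    moreover have "(\<Sum>k. diffs (?c i) k * s ^ k) = (\<Sum>k. \<Sum>l\<in>UNIV. B $ i $ l * (?c l k * s ^ k))"
    proof (rule suminf_cong)
      fix k
      have "diffs (?c i) k = mat_pow B (Suc k) $ i $ j / fact k"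
        by (simp add: diffs_def del: of_nat_Suc)
      also have "\<dots> = (\<Sum>l\<in>UNIV. B $ i $ l * ?c l k)"
        by (simp add: matrix_matrix_mult_def sum_divide_distrib)
      finally show "diffs (?c i) k * s ^ k = (\<Sum>l\<in>UNIV. B $ i $ l * (?c l k * s ^ k))"
        by (simp add: sum_distrib_right mult.assoc)
    qed
    moreover have "(\<Sum>k. \<Sum>l\<in>UNIV. B $ i $ l * (?c l k * s ^ k)) = (\<Sum>l\<in>UNIV. \<Sum>k. B $ i $ l * (?c l k * s ^ k))"
      by (intro suminf_sum summable_mult exp_entry_summable)
    moreover have "(\<Sum>k. B $ i $ l * (?c l k * s ^ k)) = B $ i $ l * E_mat B (- s) $ l $ j" for l
      unfolding E_mat_entry by (intro suminf_mult exp_entry_summable)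
    ultimately show ?thesis
      by (simp add: E_mat_entry[abs_def] matrix_matrix_mult_def)
  qed
  then show ?thesis
    unfolding has_vector_derivative_def has_field_derivative_def
    by (subst has_derivative_componentwise_within) (auto simp: Basis_vec_def inner_axis mult_commute_abs)
qed

text \<open>The product exp(q B) exp((- s - r - q) B) has derivative 0 in \<open>q\<close>, because
  \<open>B\<close> commutes with its exponential. Comparing its values at \<open>q = - s\<close> and
  \<open>q = 0\<close> gives the law without multiplying series.\<close>

lemma E_mat_add: "E_mat B s ** E_mat B r = E_mat B (s + r)"
proof -
  let ?H = "\<lambda>q. E_mat B (- q) ** E_mat B (- (- s - r - q))"
  have "(?H has_vector_derivative 0) (at q)" for q
  proof -
    have "((\<lambda>q. E_mat B (- (- s - r - q))) has_vector_derivative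
        - (B ** E_mat B (- (- s - r - q)))) (at q)"
    proof -
      have "((\<lambda>q. - s - r - q) has_vector_derivative - 1) (at q)"
        by (auto intro!: derivative_eq_intros)
      from vector_diff_chain_at[OF this, where g = "\<lambda>s. E_mat B (- s)", OF flow_has_vector_derivative]
      show ?thesis by (simp add: o_def)
    qed
    then have "(?H has_vector_derivative
        E_mat B (- q) ** (- (B ** E_mat B (- (- s - r - q)))) +
        (B ** E_mat B (- q)) ** E_mat B (- (- s - r - q))) (at q)"
      by (intro bounded_bilinear.has_vector_derivative[OF bounded_bilinear_matrix_matrix_mult]
          flow_has_vector_derivative)
    then show ?thesis
      by (simp add: bounded_bilinear.minus_right[OF bounded_bilinear_matrix_matrix_mult]
          E_mat_commute[of B "- q"] matrix_mul_assoc)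
  qed
  then obtain c where "\<And>q. ?H q = c"
    using has_vector_derivative_zero_constant[of UNIV ?H] by (metis UNIV_I convex_UNIV)
  then have "?H (- s) = ?H 0" by metis
  then show ?thesis by (simp add: add.commute)
qed

lemma E_mat_inverse: "E_mat B s *v (E_mat B (- s) *v x) = x"
  by (simp add: matrix_vector_mul_assoc E_mat_add)

lemma isCont_E_mat: "isCont (E_mat B) s"
proof -
  have "isCont (\<lambda>r. E_mat B (- r)) (- s)"
    using flow_has_vector_derivative by (rule has_vector_derivative_continuous)
  then have "isCont ((\<lambda>r. E_mat B (- r)) \<circ> uminus) s"
    by (intro continuous_at_compose) auto
  then show ?thesis by (simp add: o_def)
qed

lemma tendsto_E_mat_mult:
  assumes "(f \<longlongrightarrow> s) F" "(g \<longlongrightarrow> x) F"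
  shows "((\<lambda>q. E_mat B (f q) *v g q) \<longlongrightarrow> E_mat B s *v x) F"
  by (intro bounded_bilinear.tendsto[OF bounded_bilinear_matrix_vector_mult] assms(2)
      isCont_tendsto_compose[OF isCont_E_mat] assms(1))

lemma Y_curve_0 [simp]: "Y_curve B z 0 = z"
  by (simp add: Y_curve_def)

lemma Y_curve_Y_curve: "Y_curve B (Y_curve B z s) r = Y_curve B z (s + r)"
  by (simp add: Y_curve_def matrix_vector_mul_assoc E_mat_add add.commute)

lemma Y_curve_has_vector_derivative:
  "(Y_curve B z has_vector_derivative (B *v fst (Y_curve B z s), - 1)) (at s)"
proof -
  have "((\<lambda>s. E_mat B (- s) *v fst z) has_vector_derivative (B ** E_mat B (- s)) *v fst z) (at s)"
    by (rule bounded_linear.has_vector_derivative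
        [OF bounded_bilinear.bounded_linear_left[OF bounded_bilinear_matrix_vector_mult]
          flow_has_vector_derivative])
  moreover have "((\<lambda>s. snd z - s) has_vector_derivative - 1) (at s)"
    by (auto intro!: derivative_eq_intros)
  ultimately have "((\<lambda>s. (E_mat B (- s) *v fst z, snd z - s)) has_vector_derivative
      ((B ** E_mat B (- s)) *v fst z, - 1)) (at s)"
    by (rule has_vector_derivative_Pair)
  then show ?thesis by (simp add: Y_curve_def[abs_def] matrix_vector_mul_assoc)
qed

lemma tendsto_Y_curve:
  assumes "(f \<longlongrightarrow> z) F" "(g \<longlongrightarrow> s) F"
  shows "((\<lambda>q. Y_curve B (f q) (g q)) \<longlongrightarrow> Y_curve B z s) F"
  unfolding Y_curve_def by (intro tendsto_intros tendsto_E_mat_mult assms)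

section \<open>Continuity of the coefficients\<close>

text \<open>The group difference of \<open>z\<close> and \<zeta> tends to 0 in the Euclidean sense
  by \<open>E_mat_inverse\<close>, and all exponents in \<open>kol_norm\<close> are positive. This
  turns the Hoelder bounds into ordinary continuity.\<close>

lemma tendsto_kol_dist: "(kol_dist m B z \<longlongrightarrow> 0) (at z)"
proof -
  let ?x = "\<lambda>\<zeta>. fst \<zeta> + E_mat B (snd \<zeta>) *v (- (E_mat B (- snd z) *v fst z))"
  have x: "(?x \<longlongrightarrow> 0) (at z)"
  proof -
    have "(?x \<longlongrightarrow> fst z + E_mat B (snd z) *v (- (E_mat B (- snd z) *v fst z))) (at z)"
      by (intro tendsto_intros tendsto_E_mat_mult)
    also have "fst z + E_mat B (snd z) *v (- (E_mat B (- snd z) *v fst z)) = 0"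
      by (simp add: bounded_bilinear.minus_right[OF bounded_bilinear_matrix_vector_mult] E_mat_inverse)
    finally show ?thesis .
  qed
  have t: "((\<lambda>\<zeta>. - snd z + snd \<zeta>) \<longlongrightarrow> 0) (at z)"
    by (auto intro!: tendsto_eq_intros)
  have "((\<lambda>\<zeta>. \<bar>?x \<zeta> $ j\<bar> powr (1 / real (2 * block_of m j + 1))) \<longlongrightarrow> 0) (at z)" for j
    by (rule tendsto_zero_powrI[OF _ tendsto_const])
       (use tendsto_rabs_zero[of "\<lambda>\<zeta>. ?x \<zeta> $ j" "at z"] tendsto_vec_nth[OF x, of j] in simp_all)
  moreover have "((\<lambda>\<zeta>. \<bar>- snd z + snd \<zeta>\<bar> powr (1 / 2)) \<longlongrightarrow> 0) (at z)"
    by (rule tendsto_zero_powrI[OF _ tendsto_const]) (use tendsto_rabs_zero[OF t] in simp_all)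
  ultimately have "((\<lambda>\<zeta>. \<bar>- snd z + snd \<zeta>\<bar> powr (1 / 2) +
      (\<Sum>j\<in>UNIV. \<bar>?x \<zeta> $ j\<bar> powr (1 / real (2 * block_of m j + 1)))) \<longlongrightarrow> 0 + (\<Sum>j\<in>(UNIV::'a set). 0)) (at z)"
    by (intro tendsto_intros)
  then show ?thesis
    by (simp add: kol_dist_def[abs_def] kol_norm_def kol_mult_def kol_inv_def)
qed

lemma hoelder_imp_isCont:
  assumes M: "\<And>\<zeta>. \<bar>f z - f \<zeta>\<bar> \<le> M * kol_dist m B z \<zeta> powr \<alpha>" and "\<alpha> > 0"
  shows "isCont f z"
proof -
  have nonneg: "0 \<le> kol_dist m B z \<zeta>" for \<zeta>
    by (auto simp: kol_dist_def kol_norm_def intro!: add_nonneg_nonneg sum_nonneg)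
  have "((\<lambda>\<zeta>. M * kol_dist m B z \<zeta> powr \<alpha>) \<longlongrightarrow> M * 0) (at z)"
    by (intro tendsto_intros tendsto_zero_powrI[OF tendsto_kol_dist tendsto_const])
       (use nonneg assms in auto)
  then have lim: "((\<lambda>\<zeta>. M * kol_dist m B z \<zeta> powr \<alpha>) \<longlongrightarrow> 0) (at z)" by simp
  have "norm (f \<zeta> - f z) \<le> M * kol_dist m B z \<zeta> powr \<alpha>" for \<zeta>
    using M[of \<zeta>] by (simp add: abs_minus_commute)
  then have "((\<lambda>\<zeta>. f \<zeta> - f z) \<longlongrightarrow> 0) (at z)"
    by (intro Lim_null_comparison[OF always_eventually lim]) simp
  then show ?thesis by (simp add: isCont_def LIM_zero_iff)
qed

lemma coefficients_isCont:
  assumes "hoelder_coefficients m B a b" "i \<in> first_block m" "j \<in> first_block m"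
  shows "isCont (a i j) z" "isCont (b j) z"
proof -
  obtain \<alpha> M where "\<alpha> > 0" and M: "\<And>z \<zeta>. \<bar>a i j z - a i j \<zeta>\<bar> \<le> M * kol_dist m B z \<zeta> powr \<alpha>"
      "\<And>z \<zeta>. \<bar>b j z - b j \<zeta>\<bar> \<le> M * kol_dist m B z \<zeta> powr \<alpha>"
    using assms unfolding hoelder_coefficients_def by meson
  show "isCont (a i j) z" using M(1) \<open>\<alpha> > 0\<close> by (rule hoelder_imp_isCont)
  show "isCont (b j) z" using M(2) \<open>\<alpha> > 0\<close> by (rule hoelder_imp_isCont)
qed

section \<open>The rank condition on the drift\<close>

lemma idx_strict_mono: "i < j \<Longrightarrow> idx i < idx j"
  unfolding idx_def by (rule psubset_card_mono) auto

lemma inj_idx: "inj idx"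
  by (rule injI) (metis idx_strict_mono less_irrefl linorder_neqE)

lemma idx_less_card: "idx (i :: 'n::{finite,linorder}) < CARD('n)"
  unfolding idx_def by (rule psubset_card_mono) auto

lemma block_of_le:
  assumes "(\<Sum>k\<le>\<kappa>. m k) = CARD('n)"
  shows "block_of m (i :: 'n::{finite,linorder}) \<le> \<kappa>"
  unfolding block_of_def using idx_less_card[of i] assms by (intro Least_le) simp

lemma idx_less_block_end:
  assumes "(\<Sum>k\<le>\<kappa>. m k) = CARD('n)"
  shows "idx (i :: 'n::{finite,linorder}) < (\<Sum>l\<le>block_of m i. m l)"
  unfolding block_of_def by (rule LeastI[of _ \<kappa>]) (use idx_less_card[of i] assms in simp)

lemma block_start_le_idx: "k < block_of m i \<Longrightarrow> (\<Sum>l\<le>k. m l) \<le> idx i"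
  unfolding block_of_def by (drule not_less_Least) simp

text \<open>\<open>idx\<close> embeds the block in an interval of positions. This upper bound shows
  that the rank of the subdiagonal block is as large as its set of rows permits.\<close>

lemma card_block_le:
  assumes "(\<Sum>k\<le>\<kappa>. m k) = CARD('n)"
  shows "card {i :: 'n::{finite,linorder}. block_of m i = Suc k} \<le> m (Suc k)"
proof -
  have "idx ` {i :: 'n. block_of m i = Suc k} \<subseteq> {(\<Sum>l\<le>k. m l)..<(\<Sum>l\<le>Suc k. m l)}"
  proof clarify
    fix i :: 'n assume i: "block_of m i = Suc k"
    then show "idx i \<in> {(\<Sum>l\<le>k. m l)..<(\<Sum>l\<le>Suc k. m l)}"
      using block_start_le_idx[of k m i] idx_less_block_end[OF assms, of i]
      by (simp del: sum.atMost_Suc)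
  qed
  from card_mono[OF _ this] show ?thesis
    by (simp add: card_image inj_on_subset[OF inj_idx])
qed

lemma in_first_block:
  assumes "(\<Sum>k\<le>\<kappa>. m k) = CARD('n)" "block_of m (i :: 'n::{finite,linorder}) = 0"
  shows "i \<in> first_block m"
  using idx_less_block_end[OF assms(1), of i] assms(2) by (simp add: first_block_def)

text \<open>The range lies in the coordinate subspace of block \<open>Suc k\<close>, whose dimension
  is at most \<open>m (Suc k)\<close>, the rank; so the two subspaces coincide.\<close>

lemma subdiag_block_onto:
  fixes B :: "'n::{finite,linorder} sqmat" and v :: "(real, 'n) vec"
  assumes form: "drift_block_form \<kappa> m B" and "Suc k \<le> \<kappa>" and v: "\<And>i. block_of m i \<noteq> Suc k \<Longrightarrow> v $ i = 0"
  shows "\<exists>w. subdiag_block m B (Suc k) *v w = v"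
proof -
  let ?D = "subdiag_block m B (Suc k)"
  let ?W = "{x :: (real, 'n) vec. \<forall>i. i \<notin> {i. block_of m i = Suc k} \<longrightarrow> x $ i = 0}"
  have sum: "(\<Sum>k\<le>\<kappa>. m k) = CARD('n)" and rank: "rank ?D = m (Suc k)"
    using form \<open>Suc k \<le> \<kappa>\<close> by (auto simp: drift_block_form_def)
  have sub: "range (\<lambda>x. ?D *v x) \<subseteq> ?W"
    by (auto simp: matrix_vector_mult_def subdiag_block_def)
  moreover have "dim ?W \<le> dim (range (\<lambda>x. ?D *v x))"
    using card_block_le[OF sum, of k] rank dim_substandard_cart[where 'a = real, of "{i :: 'n. block_of m i = Suc k}"]
    unfolding dim_vec_eq rank_dim_range by (simp only:)
  moreover have "subspace (range (\<lambda>x. ?D *v x))"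
    using linear_subspace_image[OF matrix_vector_mul_linear subspace_UNIV] .
  moreover have "subspace ?W" by (auto simp: subspace_def)
  ultimately have "range (\<lambda>x. ?D *v x) = ?W" by (intro subspace_dim_equal) auto
  moreover have "v \<in> ?W" using v by auto
  ultimately show ?thesis by (metis (no_types, lifting) imageE)
qed

text \<open>Kalman's form of the Hoermander condition. By induction on \<open>k\<close>,
  \<open>S\<close> contains every vector supported in the blocks up to \<open>k\<close>: applying
  \<open>B\<close> to vectors of block \<open>k\<close> reaches all of block \<open>Suc k\<close>,
  up to an error in earlier blocks.\<close>

lemma drift_invariant_subspace_eq_UNIV:
  fixes B :: "'n::{finite,linorder} sqmat" and S :: "(real, 'n) vec set"
  assumes form: "drift_block_form \<kappa> m B" and S: "subspace S"
    and ax: "\<And>i. i \<in> first_block m \<Longrightarrow> axis i 1 \<in> S" and inv: "\<And>x. x \<in> S \<Longrightarrow> B *v x \<in> S"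
  shows "S = UNIV"
proof -
  have sum: "(\<Sum>k\<le>\<kappa>. m k) = CARD('n)"
    and zero: "\<And>i j. block_of m i > block_of m j + 1 \<Longrightarrow> B $ i $ j = 0"
    using form by (auto simp: drift_block_form_def)
  have *: "v \<in> S" if "k \<le> \<kappa>" "\<And>i. block_of m i > k \<Longrightarrow> v $ i = 0" for k v
    using that
  proof (induction k arbitrary: v)
    case 0
    have "v = (\<Sum>i\<in>UNIV. v $ i *\<^sub>R axis i 1)"
      using basis_expansion[of v] by (simp add: scalar_mult_eq_scaleR)
    also have "\<dots> = (\<Sum>i\<in>first_block m. v $ i *\<^sub>R axis i 1)"
      by (intro sum.mono_neutral_right) (use 0 in_first_block[OF sum] in auto)
    also have "\<dots> \<in> S" by (intro subspace_sum subspace_scale ax S)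
    finally show ?case .
  next
    case (Suc k)
    define v' where "v' = (\<chi> i. if block_of m i = Suc k then v $ i else 0)"
    obtain w where w: "subdiag_block m B (Suc k) *v w = v'"
      using subdiag_block_onto[OF form Suc.prems(1), of v'] by (auto simp: v'_def)
    \<comment> \<open>\<open>subdiag_block\<close> ignores the entries of \<open>w\<close> outside
      block \<open>k\<close>, but \<open>B\<close> does not, so they are cut off.\<close>
    define w' where "w' = (\<chi> i. if block_of m i = k then w $ i else 0)"
    have "w' \<in> S" using Suc.prems(1) by (intro Suc.IH) (auto simp: w'_def)
    then have "B *v w' \<in> S" by (rule inv)
    \<comment> \<open>Entries in blocks beyond \<open>Suc k\<close> vanish by the block form, those
      in block \<open>Suc k\<close> by the choice of \<open>w\<close>.\<close>
    moreover have "v - B *v w' \<in> S"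
    proof (rule Suc.IH)
      fix i :: 'n assume i: "block_of m i > k"
      show "(v - B *v w') $ i = 0"
      proof (cases "block_of m i = Suc k")
        case True
        have "(B *v w') $ i = (subdiag_block m B (Suc k) *v w) $ i"
          using True by (auto simp: matrix_vector_mult_def subdiag_block_def w'_def intro!: sum.cong)
        then show ?thesis using w True by (simp add: v'_def)
      next
        case False
        then have "(B *v w') $ i = 0"
          using i by (auto simp: matrix_vector_mult_def w'_def zero intro!: sum.neutral)
        then show ?thesis using Suc.prems(2)[of i] i False by simp
      qed
    qed (use Suc.prems in simp)
    ultimately have "(v - B *v w') + B *v w' \<in> S" using S by (intro subspace_add)
    then show ?case by simp
  qed
  have "v \<in> S" for v
    by (rule *[of \<kappa>]) (use block_of_le[OF sum] in \<open>auto simp: not_less[symmetric]\<close>)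
  then show ?thesis by blast
qed

lemma has_vector_derivative_imp_tendsto:
  assumes "(f has_vector_derivative D) (at x)"
  shows "((\<lambda>r. (1 / (r - x)) *\<^sub>R (f r - f x)) \<longlongrightarrow> D) (at x)"
proof -
  have "((\<lambda>r. (1 / norm (r - x)) *\<^sub>R (f r - (f x + (r - x) *\<^sub>R D))) \<longlongrightarrow> 0) (at x)"
    using assms by (simp add: has_vector_derivative_def has_derivative_at2)
  then have "((\<lambda>r. norm ((1 / norm (r - x)) *\<^sub>R (f r - (f x + (r - x) *\<^sub>R D)))) \<longlongrightarrow> 0) (at x)"
    by (rule tendsto_norm_zero)
  then have "((\<lambda>r. norm ((1 / (r - x)) *\<^sub>R (f r - f x) - D)) \<longlongrightarrow> 0) (at x)"
  proof (rule Lim_transform_eventually)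
    have "norm ((1 / norm (r - x)) *\<^sub>R (f r - (f x + (r - x) *\<^sub>R D))) =
      norm ((1 / (r - x)) *\<^sub>R (f r - f x) - D)" if "r \<noteq> x" for r
  proof -
    have "(1 / (r - x)) *\<^sub>R (f r - f x) - D = (1 / (r - x)) *\<^sub>R (f r - (f x + (r - x) *\<^sub>R D))"
      using that by (simp add: scaleR_diff_right scaleR_add_right)
    then show ?thesis by simp
  qed
    then show "\<forall>\<^sub>F r in at x. norm ((1 / norm (r - x)) *\<^sub>R (f r - (f x + (r - x) *\<^sub>R D))) =
        norm ((1 / (r - x)) *\<^sub>R (f r - f x) - D)"
      by (simp add: eventually_at_filter)
  qed
  then show ?thesis by (simp add: tendsto_norm_zero_iff LIM_zero_iff)
qed

text \<open>
  The span is invariant under \<open>B\<close>, because it is closed and therefore contains the derivatives of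
  the curves \<open>s \<mapsto> E_mat B s *v axis i 1\<close>.
\<close>

lemma span_flow_directions:
  fixes B :: "'n::{finite,linorder} sqmat"
  assumes form: "drift_block_form \<kappa> m B" and "\<sigma> > 0"
  shows "span {E_mat B s *v axis i 1 |s i. \<bar>s\<bar> < \<sigma> \<and> i \<in> first_block m} = UNIV" (is "span ?Q = UNIV")
proof (rule drift_invariant_subspace_eq_UNIV[OF form])
  show "axis i 1 \<in> span ?Q" if "i \<in> first_block m" for i
    using that \<open>\<sigma> > 0\<close> by (intro span_base CollectI exI[of _ 0] exI[of _ i]) auto
  have gen: "B *v q \<in> span ?Q" if "q \<in> ?Q" for q
  proof -
    obtain s i where s: "q = E_mat B s *v axis i 1" "\<bar>s\<bar> < \<sigma>" "i \<in> first_block m"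
      using \<open>q \<in> ?Q\<close> by blast
    let ?f = "\<lambda>r. E_mat B (- r) *v axis i 1 :: (real, 'n) vec"
    have "(?f has_vector_derivative (B ** E_mat B (- (- s))) *v axis i 1) (at (- s))"
      by (rule bounded_linear.has_vector_derivative
        [OF bounded_bilinear.bounded_linear_left[OF bounded_bilinear_matrix_vector_mult]
          flow_has_vector_derivative])
    then have "((\<lambda>r. (1 / (r - - s)) *\<^sub>R (?f r - ?f (- s))) \<longlongrightarrow> (B ** E_mat B (- (- s))) *v axis i 1) (at (- s))"
      by (rule has_vector_derivative_imp_tendsto)
    moreover have "\<forall>\<^sub>F r in at (- s). (1 / (r - - s)) *\<^sub>R (?f r - ?f (- s)) \<in> span ?Q"
    proof -
      have "\<forall>\<^sub>F r in at (- s). \<bar>r\<bar> < \<sigma>"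
        using s(2) by (intro order_tendstoD(2)[of abs "\<bar>- s\<bar>"] tendsto_intros) auto
      then show ?thesis
      proof eventually_elim
        case (elim r)
        then have "?f r \<in> ?Q" using s(3) by (intro CollectI exI[of _ "- r"] exI[of _ i]) auto
        moreover have "?f (- s) \<in> ?Q" using s by auto
        ultimately show ?case by (intro span_scale span_diff span_base)
      qed
    qed
    ultimately have "(B ** E_mat B (- (- s))) *v axis i 1 \<in> span ?Q"
      by (intro Lim_in_closed_set[OF closed_span]) auto
    then show ?thesis using s(1) by (simp add: matrix_vector_mul_assoc)
  qed
  have "subspace {x. B *v x \<in> span ?Q}"
    using linear_subspace_vimage[OF matrix_vector_mul_linear subspace_span, of B ?Q]
    by (simp add: vimage_def)
  moreover have "?Q \<subseteq> {x. B *v x \<in> span ?Q}"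
    by (rule subsetI, rule CollectI, rule gen)
  ultimately have "span ?Q \<subseteq> {x. B *v x \<in> span ?Q}"
    by (intro span_minimal)
  then show "B *v x \<in> span ?Q" if "x \<in> span ?Q" for x
    using that by (rule subsetD[THEN CollectD])
qed (rule subspace_span)

section \<open>Calculus along horizontal directions\<close>

text \<open>Mean value inequality for \<open>g t - t * c\<close>, with \<tau> of either sign. For
  \<open>c = 0\<close> it is a Lipschitz bound along a flow line or a horizontal line; with
  \<open>c\<close> the value of a derivative it yields differentiability.\<close>

lemma mean_value_estimate:
  fixes g :: "real \<Rightarrow> real"
  assumes "\<And>t. t \<in> closed_segment 0 \<tau> \<Longrightarrow> (g has_real_derivative g' t) (at t)"
    and "\<And>t. t \<in> closed_segment 0 \<tau> \<Longrightarrow> \<bar>g' t - c\<bar> \<le> e"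
  shows "\<bar>g \<tau> - g 0 - \<tau> * c\<bar> \<le> e * \<bar>\<tau>\<bar>"
proof -
  let ?S = "closed_segment 0 \<tau>"
  have "((\<lambda>t. g t - t * c) has_field_derivative (g' t - c)) (at t within ?S)" if "t \<in> ?S" for t
    using DERIV_diff[OF assms(1)[OF that] DERIV_cmult_right[OF DERIV_ident, of c]]
    by (simp add: has_field_derivative_at_within)
  then have "norm ((g \<tau> - \<tau> * c) - (g 0 - 0 * c)) \<le> e * norm (\<tau> - 0)"
    by (rule field_differentiable_bound[where S = ?S, rotated]) (simp_all add: assms(2))
  then show ?thesis by simp
qed

text \<open>The second derivative is given only at 0. If it were negative, \<open>\<phi>'\<close>
  would be negative just to the right of 0, and \<phi> would fall below its minimum by the mean
  value theorem.\<close>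

lemma second_order_minimum:
  fixes \<phi> :: "real \<Rightarrow> real"
  assumes r: "r > 0" and d1: "\<And>h. \<bar>h\<bar> < r \<Longrightarrow> (\<phi> has_real_derivative \<phi>' h) (at h)"
    and d2: "(\<phi>' has_real_derivative D) (at 0)" and mn: "\<And>h. \<bar>h\<bar> < r \<Longrightarrow> \<phi> 0 \<le> \<phi> h"
  shows "\<phi>' 0 = 0" "0 \<le> D"
proof -
  show 0: "\<phi>' 0 = 0"
    by (rule DERIV_local_min[OF d1 r]) (use r mn in auto)
  show "0 \<le> D"
  proof (rule ccontr)
    assume "\<not> 0 \<le> D"
    then obtain d where d: "d > 0" "\<And>h. 0 < h \<Longrightarrow> h < d \<Longrightarrow> \<phi>' h < 0"
      using DERIV_neg_dec_right[OF d2] 0 by auto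
    define h where "h = min d r / 2"
    have h: "0 < h" "h < d" "h < r" using d r by (auto simp: h_def)
    obtain z where z: "0 < z" "z < h" "\<phi> h - \<phi> 0 = (h - 0) * \<phi>' z"
      using MVT2[OF h(1), of \<phi> \<phi>'] d1 h by (metis abs_of_nonneg le_less_trans)
    then have "\<phi> h < \<phi> 0" using d(2)[of z] h by (smt (verit) mult_pos_neg)
    then show False using mn[of h] h by simp
  qed
qed

definition hvec :: "'n set \<Rightarrow> ('n \<Rightarrow> real) \<Rightarrow> 'n::finite point" where
  "hvec J \<xi> = (\<Sum>i\<in>J. \<xi> i *\<^sub>R (axis i 1, 0))"

lemma space_line_eq: "space_line i z h = z + h *\<^sub>R (axis i 1, 0)"
  by (simp add: space_line_def prod_eq_iff)

lemma space_line_0 [simp]: "space_line i z 0 = z"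
  by (simp add: space_line_def)

lemma partial_has_real_derivative:
  assumes "has_partial i f (space_line i z h)"
  shows "((\<lambda>h. f (space_line i z h)) has_real_derivative partial i f (space_line i z h)) (at h)"
proof -
  have "((\<lambda>k. f (space_line i (space_line i z h) k)) has_real_derivative partial i f (space_line i z h)) (at 0)"
    using assms unfolding has_partial_def partial_def by (simp add: DERIV_deriv_iff_field_differentiable)
  then have "((\<lambda>k. f (space_line i z (k + h))) has_real_derivative partial i f (space_line i z h)) (at 0)"
    by (simp add: space_line_eq algebra_simps)
  then show ?thesis using DERIV_shift[of "\<lambda>h. f (space_line i z h)" _ 0 h] by simp
qed

text \<open>The classical argument from continuous partial derivatives to differentiability,
  restricted to the directions in \<open>J\<close>. The set \<open>J\<close> is kept general for the
  induction, which adds one direction at a time.\<close>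

lemma hvec_directional_derivative:
  fixes f :: "'n::finite point \<Rightarrow> real"
  assumes "open \<Omega>" and hp: "\<And>i z. i \<in> J \<Longrightarrow> z \<in> \<Omega> \<Longrightarrow> has_partial i f z"
    and cp: "\<And>i. i \<in> J \<Longrightarrow> continuous_on \<Omega> (partial i f)" and "z \<in> \<Omega>"
  shows "((\<lambda>h. f (z + h *\<^sub>R hvec J \<xi>)) has_real_derivative (\<Sum>i\<in>J. \<xi> i * partial i f z)) (at 0)"
proof -
  have "finite J" by simp
  then show ?thesis using hp cp
  proof (induction J rule: finite_induct)
    case empty
    then show ?case by (simp add: hvec_def)
  next
    case (insert p J)
    let ?v = "hvec J \<xi>" and ?c = "partial p f z"
    let ?w = "hvec (insert p J) \<xi>"
    have w: "?w = ?v + \<xi> p *\<^sub>R (axis p 1, 0)" using insert.hyps by (simp add: hvec_def add.commute)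
    have IH: "((\<lambda>h. f (z + h *\<^sub>R ?v)) has_real_derivative (\<Sum>i\<in>J. \<xi> i * partial i f z)) (at 0)"
      by (rule insert.IH) (use insert.prems in auto)
    \<comment> \<open>The increment in the new direction starts from a moving point and not from
      \<open>z\<close>; continuity of the partial derivative at \<open>z\<close> makes up for
      this.\<close>
    have "((\<lambda>h. f (z + h *\<^sub>R ?w) - f (z + h *\<^sub>R ?v)) has_real_derivative \<xi> p * ?c) (at 0)"
      unfolding has_field_derivative_iff
    proof (rule LIM_I)
      fix e :: real assume "e > 0"
      define e' where "e' = e / (\<bar>\<xi> p\<bar> + 1)"
      have e': "e' > 0" "e' * \<bar>\<xi> p\<bar> < e" using \<open>e > 0\<close> by (auto simp: e'_def field_simps)
      have "isCont (partial p f) z"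
        using insert.prems(2)[of p] \<open>open \<Omega>\<close> \<open>z \<in> \<Omega>\<close> by (simp add: continuous_on_eq_continuous_at)
      then have "\<forall>\<^sub>F y in nhds z. dist (partial p f y) ?c < e'"
        using e'(1) by (intro tendstoD) (auto simp: continuous_within tendsto_nhds_iff)
      moreover have "\<forall>\<^sub>F y in nhds z. y \<in> \<Omega>" using \<open>open \<Omega>\<close> \<open>z \<in> \<Omega>\<close> by (rule eventually_nhds_in_open)
      ultimately have "\<forall>\<^sub>F y in nhds z. y \<in> \<Omega> \<and> dist (partial p f y) ?c < e'"
        by eventually_elim simp
      then obtain r where r: "r > 0" "\<And>y. dist y z < r \<Longrightarrow> y \<in> \<Omega> \<and> dist (partial p f y) ?c < e'"
        unfolding eventually_nhds_metric by blast
      \<comment> \<open>Keeps every intermediate point, after the step along \<open>?v\<close> and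
        part of the step in direction \<open>p\<close>, within \<open>r\<close> of
        \<open>z\<close>.\<close>
      define s where "s = r / (norm ?v + \<bar>\<xi> p\<bar> + 1)"
      have s: "s > 0" "s * (norm ?v + \<bar>\<xi> p\<bar>) < r" using r by (auto simp: s_def field_simps add_pos_nonneg)
      show "\<exists>s>0. \<forall>x. x \<noteq> 0 \<and> norm (x - 0) < s \<longrightarrow>
          norm ((f (z + x *\<^sub>R ?w) - f (z + x *\<^sub>R ?v) - (f (z + 0 *\<^sub>R ?w) - f (z + 0 *\<^sub>R ?v))) / (x - 0) - \<xi> p * ?c) < e"
      proof (intro exI[of _ s] conjI allI impI)
        fix h :: real assume h: "h \<noteq> 0 \<and> norm (h - 0) < s"
        let ?q = "z + h *\<^sub>R ?v"
        have inb: "space_line p ?q t \<in> \<Omega> \<and> dist (partial p f (space_line p ?q t)) ?c < e'"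
          if "t \<in> closed_segment 0 (h * \<xi> p)" for t
        proof (rule r(2))
          have t: "\<bar>t\<bar> \<le> \<bar>h\<bar> * \<bar>\<xi> p\<bar>"
            using that by (auto simp: closed_segment_eq_real_ivl abs_mult[symmetric] split: if_splits)
          have "dist (space_line p ?q t) z = norm (h *\<^sub>R ?v + t *\<^sub>R (axis p 1, 0))"
            by (simp add: space_line_eq dist_norm)
          also have "\<dots> \<le> norm (h *\<^sub>R ?v) + norm (t *\<^sub>R (axis p 1, 0) :: 'n point)"
            by (rule norm_triangle_ineq)
          also have "\<dots> = \<bar>h\<bar> * norm ?v + \<bar>t\<bar>" by (simp add: norm_Pair norm_axis_1)
          also have "\<dots> \<le> \<bar>h\<bar> * (norm ?v + \<bar>\<xi> p\<bar>)" using t by (simp add: algebra_simps)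
          also have "\<dots> \<le> s * (norm ?v + \<bar>\<xi> p\<bar>)" using h by (intro mult_right_mono) auto
          finally show "dist (space_line p ?q t) z < r" using s by simp
        qed
        have "\<bar>f (space_line p ?q (h * \<xi> p)) - f (space_line p ?q 0) - (h * \<xi> p) * ?c\<bar> \<le> e' * \<bar>h * \<xi> p\<bar>"
        proof (rule mean_value_estimate)
          fix t assume "t \<in> closed_segment 0 (h * \<xi> p)"
          note t = inb[OF this]
          show "((\<lambda>t. f (space_line p ?q t)) has_real_derivative partial p f (space_line p ?q t)) (at t)"
            using t insert.prems(1)[of p] by (intro partial_has_real_derivative) auto
          show "\<bar>partial p f (space_line p ?q t) - ?c\<bar> \<le> e'"
            using t by (simp add: dist_real_def)
        qed
        moreover have "space_line p ?q (h * \<xi> p) = z + h *\<^sub>R ?w"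
          by (simp add: space_line_eq w algebra_simps)
        ultimately have "\<bar>f (z + h *\<^sub>R ?w) - f ?q - (h * \<xi> p) * ?c\<bar> \<le> e' * \<bar>\<xi> p\<bar> * \<bar>h\<bar>"
          by (simp add: abs_mult mult_ac)
        also have "\<dots> < e * \<bar>h\<bar>" using e'(2) h by simp
        finally have "\<bar>f (z + h *\<^sub>R ?w) - f ?q - (h * \<xi> p) * ?c\<bar> / \<bar>h\<bar> < e" using h by (simp add: field_simps)
        moreover have "(f (z + h *\<^sub>R ?w) - f ?q) / h - \<xi> p * ?c = (f (z + h *\<^sub>R ?w) - f ?q - (h * \<xi> p) * ?c) / h"
          using h by (simp add: field_simps)
        ultimately show "norm ((f (z + h *\<^sub>R ?w) - f (z + h *\<^sub>R ?v) - (f (z + 0 *\<^sub>R ?w) - f (z + 0 *\<^sub>R ?v))) / (h - 0) - \<xi> p * ?c) < e"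
          by simp
      qed (use s in auto)
    qed
    from DERIV_add[OF this IH] show ?case using insert.hyps by (simp add: algebra_simps)
  qed
qed

lemma hvec_line_derivative:
  fixes f :: "'n::finite point \<Rightarrow> real"
  assumes "open \<Omega>" and hp: "\<And>i z. i \<in> J \<Longrightarrow> z \<in> \<Omega> \<Longrightarrow> has_partial i f z"
    and cp: "\<And>i. i \<in> J \<Longrightarrow> continuous_on \<Omega> (partial i f)" and "z + h *\<^sub>R hvec J \<xi> \<in> \<Omega>"
  shows "((\<lambda>h. f (z + h *\<^sub>R hvec J \<xi>)) has_real_derivative
           (\<Sum>i\<in>J. \<xi> i * partial i f (z + h *\<^sub>R hvec J \<xi>))) (at h)"
  using hvec_directional_derivative[OF assms, where \<xi> = \<xi>] 
    DERIV_shift[of "\<lambda>h. f (z + h *\<^sub>R hvec J \<xi>)" _ 0 h]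
  by (simp add: algebra_simps)

section \<open>Continuity of the solution\<close>

abbreviation X_field :: "'n::finite \<Rightarrow> 'n point" where
  "X_field i \<equiv> (axis i 1, 0)"

abbreviation Y_field :: "'n::finite sqmat \<Rightarrow> 'n point \<Rightarrow> 'n point" where
  "Y_field B z \<equiv> (B *v fst z, - 1)"

locale kolmogorov_solution =
  fixes \<kappa> :: nat and m :: "nat \<Rightarrow> nat" and B :: "'n::{finite,linorder} sqmat"
    and a :: "'n \<Rightarrow> 'n \<Rightarrow> 'n point \<Rightarrow> real" and b :: "'n \<Rightarrow> 'n point \<Rightarrow> real"
    and \<Omega> :: "'n point set" and u :: "'n point \<Rightarrow> real"
  assumes kolmogorov: "kolmogorov_operator \<kappa> m B a b"
    and open_domain: "open \<Omega>"
    and solution: "is_solution m B a b \<Omega> u"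
    and nonneg: "\<And>z. z \<in> \<Omega> \<Longrightarrow> 0 \<le> u z"
begin

lemma has_partial_u: "i \<in> first_block m \<Longrightarrow> z \<in> \<Omega> \<Longrightarrow> has_partial i u z"
  and continuous_partial_u: "i \<in> first_block m \<Longrightarrow> continuous_on \<Omega> (partial i u)"
  and has_partial_partial_u:
    "i \<in> first_block m \<Longrightarrow> j \<in> first_block m \<Longrightarrow> z \<in> \<Omega> \<Longrightarrow> has_partial i (partial j u) z"
  and continuous_partial_partial_u:
    "i \<in> first_block m \<Longrightarrow> j \<in> first_block m \<Longrightarrow> continuous_on \<Omega> (partial i (partial j u))"
  and continuous_lie_deriv_u: "continuous_on \<Omega> (lie_deriv B u)"
  and equation: "z \<in> \<Omega> \<Longrightarrow>
        (\<Sum>i\<in>first_block m. \<Sum>j\<in>first_block m. a i j z * partial i (partial j u) z)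
        + (\<Sum>j\<in>first_block m. b j z * partial j u z) + lie_deriv B u z = 0"
  using solution unfolding is_solution_def by blast+

text \<open>The definition differentiates only at time 0; the flow property
  \<open>Y_curve_Y_curve\<close> transports this to time \<open>s\<close>.\<close>

lemma lie_derivative_along_flow:
  assumes "Y_curve B z s \<in> \<Omega>"
  shows "((\<lambda>s. u (Y_curve B z s)) has_real_derivative lie_deriv B u (Y_curve B z s)) (at s)"
proof -
  let ?w = "Y_curve B z s"
  have "has_lie_deriv B u ?w" using solution assms by (auto simp: is_solution_def)
  then obtain L where L: "((\<lambda>s. (u (Y_curve B ?w s) - u (Y_curve B ?w 0)) / s) \<longlongrightarrow> L) (at 0)"
    by (auto simp: has_lie_deriv_def)
  then have "lie_deriv B u ?w = L" unfolding lie_deriv_def by (intro tendsto_Lim) auto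
  then have "((\<lambda>s. u (Y_curve B ?w s)) has_real_derivative lie_deriv B u ?w) (at 0)"
    using L by (simp add: has_field_derivative_iff)
  then show ?thesis
    using DERIV_shift[of "\<lambda>s. u (Y_curve B z s)" _ 0 s] by (simp add: Y_curve_Y_curve add.commute)
qed

lemma local_derivative_bound:
  assumes "z \<in> \<Omega>"
  shows "\<exists>r>0. \<exists>L\<ge>0. ball z r \<subseteq> \<Omega> \<and>
           (\<forall>y\<in>ball z r. \<bar>lie_deriv B u y\<bar> \<le> L \<and> (\<forall>i\<in>first_block m. \<bar>partial i u y\<bar> \<le> L))"
proof -
  obtain r where r: "r > 0" "cball z r \<subseteq> \<Omega>"
    using open_domain assms by (meson open_contains_cball)
  let ?g = "\<lambda>y. \<bar>lie_deriv B u y\<bar> + (\<Sum>i\<in>first_block m. \<bar>partial i u y\<bar>)"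
  have cont: "continuous_on (cball z r) ?g"
    by (intro continuous_intros continuous_on_subset[OF continuous_lie_deriv_u r(2)]
        continuous_on_subset[OF continuous_partial_u r(2)])
  have "cball z r \<noteq> {}" using r(1) by simp
  from continuous_attains_sup[OF compact_cball this cont]
  obtain p where p: "\<And>y. y \<in> cball z r \<Longrightarrow> ?g y \<le> ?g p" by blast
  have "\<bar>lie_deriv B u y\<bar> \<le> ?g p \<and> (\<forall>i\<in>first_block m. \<bar>partial i u y\<bar> \<le> ?g p)" if "y \<in> ball z r" for y
  proof (intro conjI ballI)
    have y: "?g y \<le> ?g p" using that by (intro p) auto
    have "0 \<le> (\<Sum>i\<in>first_block m. \<bar>partial i u y\<bar>)" by (intro sum_nonneg) auto
    then show "\<bar>lie_deriv B u y\<bar> \<le> ?g p" using y by linarith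
    fix i :: 'n assume "i \<in> first_block m"
    then have "\<bar>partial i u y\<bar> \<le> (\<Sum>i\<in>first_block m. \<bar>partial i u y\<bar>)"
      by (intro member_le_sum) auto
    then show "\<bar>partial i u y\<bar> \<le> ?g p" using y by linarith
  qed
  moreover have "0 \<le> ?g p" by (intro add_nonneg_nonneg sum_nonneg) auto
  ultimately show ?thesis using r by (intro exI[of _ r] conjI exI[of _ "?g p"]) (auto simp: subset_iff)
qed

lemma closed_segment_0_abs: "t \<in> closed_segment 0 s \<Longrightarrow> \<bar>t\<bar> \<le> \<bar>s :: real\<bar>"
  by (auto simp: closed_segment_eq_real_ivl split: if_splits)

text \<open>
  The shift by \<open>h *\<^sub>R (E_mat B s *v axis i 1)\<close> is obtained by flowing along \<open>Y\<close> for the time \<open>s\<close>,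
  moving along \<open>X\<^sub>i\<close> and flowing back.
\<close>

lemma shift_estimates:
  assumes "z \<in> \<Omega>"
  shows "\<exists>\<sigma>>0. \<exists>L\<ge>0.
     (\<forall>\<zeta> s. dist \<zeta> z < \<sigma> \<and> \<bar>s\<bar> < \<sigma> \<longrightarrow> \<bar>u (Y_curve B \<zeta> s) - u \<zeta>\<bar> \<le> L * \<bar>s\<bar>) \<and>
     (\<forall>\<zeta> s h. \<forall>i\<in>first_block m. dist \<zeta> z < \<sigma> \<and> \<bar>s\<bar> < \<sigma> \<and> \<bar>h\<bar> < \<sigma> \<and>
        dist (\<zeta> + (h *\<^sub>R (E_mat B s *v axis i 1), 0)) z < \<sigma> \<longrightarrow>
        \<bar>u (\<zeta> + (h *\<^sub>R (E_mat B s *v axis i 1), 0)) - u \<zeta>\<bar> \<le> L * (2 * \<bar>s\<bar> + \<bar>h\<bar>))"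
proof -
  obtain r L where r: "r > 0" "ball z r \<subseteq> \<Omega>" and "L \<ge> 0"
    and LY: "\<And>y. y \<in> ball z r \<Longrightarrow> \<bar>lie_deriv B u y\<bar> \<le> L"
    and LX: "\<And>y i. y \<in> ball z r \<Longrightarrow> i \<in> first_block m \<Longrightarrow> \<bar>partial i u y\<bar> \<le> L"
    using local_derivative_bound[OF assms] by blast
  have "((\<lambda>q. Y_curve B (fst q) (snd q)) \<longlongrightarrow> Y_curve B z 0) (nhds (z, 0))"
    by (intro tendsto_Y_curve tendsto_eq_rhs[OF tendsto_fst[OF filterlim_ident]]
        tendsto_eq_rhs[OF tendsto_snd[OF filterlim_ident]]) simp_all
  then have "\<forall>\<^sub>F q in nhds (z, 0). dist (Y_curve B (fst q) (snd q)) z < r / 2"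
    using r(1) by (auto dest!: tendstoD[of _ _ _ "r / 2"])
  then obtain \<sigma>0 where \<sigma>0: "\<sigma>0 > 0"
    "\<And>q. dist q (z, 0) < \<sigma>0 \<Longrightarrow> dist (Y_curve B (fst q) (snd q)) z < r / 2"
    unfolding eventually_nhds_metric by blast
  define \<sigma> where "\<sigma> = min (\<sigma>0 / 2) (r / 2)"
  have "\<sigma> > 0" using \<sigma>0 r by (simp add: \<sigma>_def)
  have Yb: "dist (Y_curve B \<zeta> s) z < r / 2" if "dist \<zeta> z < \<sigma>" "\<bar>s\<bar> < \<sigma>" for \<zeta> s
  proof -
    have "dist (\<zeta>, s) (z, 0) \<le> dist \<zeta> z + \<bar>s\<bar>"
      using sqrt_sum_squares_le_sum_abs[of "dist \<zeta> z" s] by (simp add: dist_Pair_Pair dist_real_def)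
    also have "\<dots> < \<sigma>0" using that by (simp add: \<sigma>_def)
    finally show ?thesis using \<sigma>0(2)[of "(\<zeta>, s)"] by simp
  qed
  have Y: "\<bar>u (Y_curve B \<zeta> s) - u \<zeta>\<bar> \<le> L * \<bar>s\<bar>" if "dist \<zeta> z < \<sigma>" "\<bar>s\<bar> < \<sigma>" for \<zeta> s
  proof -
    have inb: "Y_curve B \<zeta> t \<in> ball z r" if "t \<in> closed_segment 0 s" for t
      using Yb[of \<zeta> t] \<open>dist \<zeta> z < \<sigma>\<close> \<open>\<bar>s\<bar> < \<sigma>\<close> closed_segment_0_abs[OF that] r(1)
      by (auto simp: dist_commute)
    have "\<bar>u (Y_curve B \<zeta> s) - u (Y_curve B \<zeta> 0) - s * 0\<bar> \<le> L * \<bar>s\<bar>"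
      by (rule mean_value_estimate[where g = "\<lambda>s. u (Y_curve B \<zeta> s)" and
            g' = "\<lambda>s. lie_deriv B u (Y_curve B \<zeta> s)"])
         (use inb r(2) LY in \<open>auto intro!: lie_derivative_along_flow simp del: mem_ball\<close>)
    then show ?thesis by simp
  qed
  have X: "\<bar>u (\<zeta> + (h *\<^sub>R (E_mat B s *v axis i 1), 0)) - u \<zeta>\<bar> \<le> L * (2 * \<bar>s\<bar> + \<bar>h\<bar>)"
    if "i \<in> first_block m" "dist \<zeta> z < \<sigma>" "\<bar>s\<bar> < \<sigma>" "\<bar>h\<bar> < \<sigma>"
      "dist (\<zeta> + (h *\<^sub>R (E_mat B s *v axis i 1), 0)) z < \<sigma>" for \<zeta> s h i
  proof -
    let ?q = "\<zeta> + (h *\<^sub>R (E_mat B s *v axis i 1), 0)" and ?p = "Y_curve B \<zeta> s"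
    \<comment> \<open>The spatial part of the flow for time \<open>s\<close> is
      \<open>E_mat B (- s)\<close>, which undoes the factor \<open>E_mat B s\<close>: after time
      \<open>s\<close> the two points differ by \<open>h\<close> along the axis
      \<open>i\<close>.\<close>
    have end_eq: "Y_curve B ?q s = space_line i ?p h"
      by (simp add: Y_curve_def space_line_def matrix_vector_right_distrib matrix_vector_mult_scaleR)
         (metis E_mat_inverse minus_minus)
    have inb: "space_line i ?p t \<in> ball z r" if "t \<in> closed_segment 0 h" for t
    proof -
      have "dist (space_line i ?p t) ?p = \<bar>t\<bar>" by (simp add: space_line_eq dist_norm norm_Pair)
      then show ?thesis
        using Yb[of \<zeta> s] \<open>dist \<zeta> z < \<sigma>\<close> \<open>\<bar>s\<bar> < \<sigma>\<close> \<open>\<bar>h\<bar> < \<sigma>\<close> closed_segment_0_abs[OF that]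
          dist_triangle[of "space_line i ?p t" z ?p]
        by (simp add: \<sigma>_def dist_commute)
    qed
    have "\<bar>u (space_line i ?p h) - u (space_line i ?p 0) - h * 0\<bar> \<le> L * \<bar>h\<bar>"
      by (rule mean_value_estimate[where g = "\<lambda>h. u (space_line i ?p h)" and
            g' = "\<lambda>h. partial i u (space_line i ?p h)"])
         (use inb r(2) LX that(1) in \<open>auto intro!: partial_has_real_derivative has_partial_u simp del: mem_ball\<close>)
    then have "\<bar>u (Y_curve B ?q s) - u ?p\<bar> \<le> L * \<bar>h\<bar>" by (simp add: end_eq)
    moreover have "\<bar>u ?p - u \<zeta>\<bar> \<le> L * \<bar>s\<bar>" "\<bar>u (Y_curve B ?q s) - u ?q\<bar> \<le> L * \<bar>s\<bar>"
      using Y that by auto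
    ultimately have "\<bar>u ?q - u \<zeta>\<bar> \<le> L * \<bar>s\<bar> + L * \<bar>h\<bar> + L * \<bar>s\<bar>" by linarith
    then show ?thesis by (simp add: algebra_simps)
  qed
  show ?thesis using \<open>\<sigma> > 0\<close> \<open>L \<ge> 0\<close> X Y by blast
qed

text \<open>For fixed \<open>s\<close> the bound
  \<open>L * (2 * \<bar>s\<bar> + \<bar>h\<bar>)\<close> does not tend to 0 with \<open>h\<close>.
  It suffices because directions with arbitrarily small \<open>s\<close> already span: \<sigma>' is
  chosen from \<open>e\<close>, then a basis \<open>T\<close> among the directions with
  \<open>\<bar>s\<bar> < \<sigma>'\<close>, and only then the bound \<delta> on the coordinates,
  which depends on \<open>T\<close>. The time coordinate is adjusted separately along the
  flow.\<close>

lemma isCont_u: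
  assumes "z \<in> \<Omega>"
  shows "isCont u z"
  unfolding isCont_def
proof (rule tendstoI)
  fix e :: real assume "e > 0"
  obtain \<sigma> L where "\<sigma> > 0" "L \<ge> 0"
    and Y: "\<And>\<zeta> s. dist \<zeta> z < \<sigma> \<Longrightarrow> \<bar>s\<bar> < \<sigma> \<Longrightarrow> \<bar>u (Y_curve B \<zeta> s) - u \<zeta>\<bar> \<le> L * \<bar>s\<bar>"
    and X: "\<And>\<zeta> s h i. i \<in> first_block m \<Longrightarrow> dist \<zeta> z < \<sigma> \<Longrightarrow> \<bar>s\<bar> < \<sigma> \<Longrightarrow> \<bar>h\<bar> < \<sigma> \<Longrightarrow>
        dist (\<zeta> + (h *\<^sub>R (E_mat B s *v axis i 1), 0)) z < \<sigma> \<Longrightarrow>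
        \<bar>u (\<zeta> + (h *\<^sub>R (E_mat B s *v axis i 1), 0)) - u \<zeta>\<bar> \<le> L * (2 * \<bar>s\<bar> + \<bar>h\<bar>)"
    using shift_estimates[OF assms] by metis
  define N where "N = real CARD('n)"
  \<comment> \<open>At most \<open>N\<close> basis steps of cost \<open>c\<close> use up
    \<open>e / 2\<close>; the other half is reserved for the time shift.\<close>
  define c where "c = e / (2 * N)"
  have "N > 0" "c > 0" using \<open>e > 0\<close> by (auto simp: N_def c_def)
  define \<sigma>' where "\<sigma>' = min \<sigma> (c / (3 * L + 1))"
  have \<sigma>': "\<sigma>' > 0" "\<sigma>' \<le> \<sigma>" "L * (3 * \<sigma>') \<le> c"
  proof -
    show "\<sigma>' > 0" "\<sigma>' \<le> \<sigma>" using \<open>\<sigma> > 0\<close> \<open>c > 0\<close> \<open>L \<ge> 0\<close> by (auto simp: \<sigma>'_def)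
    have "L * (3 * \<sigma>') \<le> L * (3 * (c / (3 * L + 1)))"
      using \<open>L \<ge> 0\<close> by (intro mult_left_mono) (auto simp: \<sigma>'_def)
    also have "\<dots> \<le> c" using \<open>L \<ge> 0\<close> \<open>c > 0\<close> by (simp add: field_simps)
    finally show "L * (3 * \<sigma>') \<le> c" .
  qed
  define Q where "Q = {E_mat B s *v axis i 1 |s i. \<bar>s\<bar> < \<sigma>' \<and> i \<in> first_block m}"
  have "span Q = UNIV"
    unfolding Q_def using kolmogorov \<sigma>'(1)
    by (intro span_flow_directions) (auto simp: kolmogorov_operator_def)
  then obtain T where T: "T \<subseteq> Q" "independent T" "span T = UNIV"
    by (metis maximal_independent_subset span_eq top.extremum_uniqueI span_minimal subspace_span)
  then have "finite T" "card T \<le> CARD('n)"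
    using independent_bound[OF T(2)] by auto
  have step: "\<bar>u (\<zeta> + (h *\<^sub>R q, 0)) - u \<zeta>\<bar> \<le> c"
    if "q \<in> T" "dist \<zeta> z < \<sigma>" "\<bar>h\<bar> < \<sigma>'" "dist (\<zeta> + (h *\<^sub>R q, 0)) z < \<sigma>" for q \<zeta> h
  proof -
    obtain s i where s: "q = E_mat B s *v axis i 1" "\<bar>s\<bar> < \<sigma>'" "i \<in> first_block m"
      using \<open>q \<in> T\<close> T(1) by (auto simp: Q_def)
    then have "\<bar>u (\<zeta> + (h *\<^sub>R q, 0)) - u \<zeta>\<bar> \<le> L * (2 * \<bar>s\<bar> + \<bar>h\<bar>)"
      using that \<sigma>' by (auto intro!: X)
    also have "\<dots> \<le> L * (3 * \<sigma>')" using s that \<open>L \<ge> 0\<close> by (intro mult_left_mono) auto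
    finally show ?thesis using \<sigma>' by linarith
  qed
  define K where "K = (\<Sum>q\<in>T. norm q)"
  have "K \<ge> 0" unfolding K_def by (intro sum_nonneg) auto
  \<comment> \<open>Chosen so that all partial sums of the chain below stay in the ball where the
    shift estimates hold.\<close>
  define \<delta> where "\<delta> = min \<sigma>' (\<sigma> / (K + 2))"
  have \<delta>: "\<delta> > 0" "\<delta> \<le> \<sigma>'" "\<delta> + \<delta> * K < \<sigma>"
  proof -
    show "\<delta> > 0" "\<delta> \<le> \<sigma>'" using \<sigma>' \<open>\<sigma> > 0\<close> \<open>K \<ge> 0\<close> by (auto simp: \<delta>_def)
    have "\<delta> * (K + 1) \<le> \<sigma> / (K + 2) * (K + 1)"
      using \<open>K \<ge> 0\<close> by (intro mult_right_mono) (auto simp: \<delta>_def)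
    also have "\<dots> < \<sigma>" using \<open>\<sigma> > 0\<close> \<open>K \<ge> 0\<close> by (simp add: field_simps)
    finally show "\<delta> + \<delta> * K < \<sigma>" by (simp add: algebra_simps)
  qed
  have chain: "\<bar>u (\<zeta> + (\<Sum>q\<in>T'. co q *\<^sub>R q, 0)) - u \<zeta>\<bar> \<le> real (card T') * c"
    if "finite T'" "T' \<subseteq> T" and \<zeta>: "dist \<zeta> z < \<delta>" and co: "\<And>q. q \<in> T \<Longrightarrow> \<bar>co q\<bar> < \<delta>" for T' \<zeta> co
    using that(1,2)
  proof (induction T' rule: finite_induct)
    case empty
    then show ?case by (simp flip: zero_prod_def)
  next
    case (insert p T')
    have inb: "dist (\<zeta> + (\<Sum>q\<in>T''. co q *\<^sub>R q, 0)) z < \<sigma>" if "T'' \<subseteq> T" for T''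
    proof -
      have "norm (\<Sum>q\<in>T''. co q *\<^sub>R q) \<le> (\<Sum>q\<in>T''. \<delta> * norm q)"
        using that co by (intro sum_norm_le) (simp add: mult_right_mono less_imp_le subsetD)
      also have "\<dots> \<le> \<delta> * K"
        unfolding K_def sum_distrib_left using that \<open>finite T\<close> \<delta>(1) by (intro sum_mono2) auto
      finally have "norm ((\<Sum>q\<in>T''. co q *\<^sub>R q, 0 :: real)) \<le> \<delta> * K" by (simp add: norm_Pair)
      then show ?thesis
        using \<zeta> \<delta>(3) norm_triangle_ineq[of "\<zeta> - z" "(\<Sum>q\<in>T''. co q *\<^sub>R q, 0)"]
        by (simp add: dist_norm algebra_simps)
    qed
    let ?\<zeta> = "\<zeta> + (\<Sum>q\<in>T'. co q *\<^sub>R q, 0)"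
    have eq: "?\<zeta> + (co p *\<^sub>R p, 0) = \<zeta> + (\<Sum>q\<in>insert p T'. co q *\<^sub>R q, 0)"
      using insert.hyps by (simp add: add.commute add.left_commute)
    have "\<bar>u (?\<zeta> + (co p *\<^sub>R p, 0)) - u ?\<zeta>\<bar> \<le> c"
    proof (rule step)
      show "dist (?\<zeta> + (co p *\<^sub>R p, 0)) z < \<sigma>" unfolding eq using insert.prems by (rule inb)
    qed (use insert.prems inb co \<delta>(2) in \<open>auto intro: less_le_trans\<close>)
    then have "\<bar>u (\<zeta> + (\<Sum>q\<in>insert p T'. co q *\<^sub>R q, 0)) - u ?\<zeta>\<bar> \<le> c" by (simp only: eq)
    moreover have "\<bar>u ?\<zeta> - u \<zeta>\<bar> \<le> real (card T') * c" using insert by auto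
    ultimately have "\<bar>u (\<zeta> + (\<Sum>q\<in>insert p T'. co q *\<^sub>R q, 0)) - u \<zeta>\<bar> \<le> c + real (card T') * c"
      by linarith
    then show ?case using insert.hyps by (simp add: algebra_simps)
  qed
  \<comment> \<open>The point of the flow line through \<open>z\<close> with the time coordinate of
    \<zeta>, so that the remaining difference is purely spatial.\<close>
  define y where "y \<zeta> = Y_curve B z (snd z - snd \<zeta>)" for \<zeta> :: "'n point"
  define d where "d \<zeta> = fst \<zeta> - fst (y \<zeta>)" for \<zeta>
  have ylim: "(y \<longlongrightarrow> z) (at z)"
  proof -
    have "((\<lambda>\<zeta>. Y_curve B z (snd z - snd \<zeta>)) \<longlongrightarrow> Y_curve B z 0) (at z)"
      by (intro tendsto_Y_curve) (auto intro!: tendsto_eq_intros)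
    then show ?thesis by (simp add: y_def[abs_def])
  qed
  have dlim: "(d \<longlongrightarrow> 0) (at z)"
    unfolding d_def 
    by (rule tendsto_eq_rhs[OF tendsto_diff[OF tendsto_fst[OF tendsto_ident_at] tendsto_fst[OF ylim]]]) simp
  have lin: "linear (\<lambda>v. representation T v q)" for q
    using T(2,3) by (intro linearI) (auto simp: real_vector.representation_add real_vector.representation_scale)
  have rlim: "((\<lambda>\<zeta>. representation T (d \<zeta>) q) \<longlongrightarrow> 0) (at z)" for q
    using dlim by (rule bounded_linear.tendsto_zero[OF linear_conv_bounded_linear[THEN iffD1, OF lin]])
  have "\<forall>\<^sub>F \<zeta> in at z. \<bar>representation T (d \<zeta>) q\<bar> < \<delta>" for q
    using tendstoD[OF rlim \<delta>(1)] by simp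
  then have "\<forall>\<^sub>F \<zeta> in at z. \<forall>q\<in>T. \<bar>representation T (d \<zeta>) q\<bar> < \<delta>"
    using \<open>finite T\<close> by (simp add: eventually_ball_finite_distrib)
  moreover have "\<forall>\<^sub>F \<zeta> in at z. dist (y \<zeta>) z < \<delta>" using ylim \<delta>(1) by (rule tendstoD)
  moreover have "\<forall>\<^sub>F \<zeta> in at z. dist (snd \<zeta>) (snd z) < min \<sigma> (e / (2 * L + 2))"
    using \<open>\<sigma> > 0\<close> \<open>e > 0\<close> \<open>L \<ge> 0\<close> by (intro tendstoD tendsto_intros) auto
  ultimately show "\<forall>\<^sub>F \<zeta> in at z. dist (u \<zeta>) (u z) < e"
  proof eventually_elim
    case (elim \<zeta>)
    let ?s = "snd z - snd \<zeta>"
    have "\<zeta> = y \<zeta> + (d \<zeta>, 0)"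
      by (simp add: d_def y_def Y_curve_def prod_eq_iff)
    moreover have "d \<zeta> = (\<Sum>q\<in>T. representation T (d \<zeta>) q *\<^sub>R q)"
      using T(2,3) \<open>finite T\<close> by (simp add: real_vector.sum_representation_eq)
    ultimately have "\<zeta> = y \<zeta> + (\<Sum>q\<in>T. representation T (d \<zeta>) q *\<^sub>R q, 0)" by simp
    moreover have "\<bar>u (y \<zeta> + (\<Sum>q\<in>T. representation T (d \<zeta>) q *\<^sub>R q, 0)) - u (y \<zeta>)\<bar> \<le> real (card T) * c"
      using elim \<open>finite T\<close> by (intro chain) auto
    ultimately have "\<bar>u \<zeta> - u (y \<zeta>)\<bar> \<le> real (card T) * c" by metis
    also have "\<dots> \<le> N * c" using \<open>card T \<le> CARD('n)\<close> \<open>c > 0\<close> by (intro mult_right_mono) (auto simp: N_def)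
    also have "\<dots> = e / 2" using \<open>N > 0\<close> by (simp add: c_def)
    finally have "\<bar>u \<zeta> - u (y \<zeta>)\<bar> \<le> e / 2" .
    moreover have "\<bar>u (y \<zeta>) - u z\<bar> < e / 2"
    proof -
      have "\<bar>u (y \<zeta>) - u z\<bar> \<le> L * \<bar>?s\<bar>"
        unfolding y_def using elim \<open>\<sigma> > 0\<close> by (intro Y) (auto simp: dist_real_def)
      also have "\<dots> \<le> L * (e / (2 * L + 2))"
        using elim \<open>L \<ge> 0\<close> by (intro mult_left_mono) (auto simp: dist_real_def)
      also have "\<dots> < e / 2" using \<open>e > 0\<close> \<open>L \<ge> 0\<close> by (simp add: field_simps)
      finally show ?thesis .
    qed
    ultimately show ?case unfolding dist_real_def by linarith
  qed
qed

lemma continuous_on_u: "continuous_on \<Omega> u"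
  using isCont_u by (intro continuous_at_imp_continuous_on) auto

section \<open>Comparison with quadratic barriers\<close>

lemma coefficient_pos:
  assumes "\<exists>i\<in>first_block m. \<xi> i \<noteq> 0"
  shows "0 < (\<Sum>i\<in>first_block m. \<Sum>j\<in>first_block m. a i j z * \<xi> i * \<xi> j)"
proof -
  have "uniformly_elliptic m a" using kolmogorov by (simp add: kolmogorov_operator_def)
  then obtain \<Lambda> where \<Lambda>: "\<Lambda> > 0" "(1 / \<Lambda>) * (\<Sum>i\<in>first_block m. \<bar>\<xi> i\<bar>\<^sup>2)
          \<le> (\<Sum>i\<in>first_block m. \<Sum>j\<in>first_block m. a i j z * \<xi> i * \<xi> j)"
    unfolding uniformly_elliptic_def by blast
  have "0 < (\<Sum>i\<in>first_block m. \<bar>\<xi> i\<bar>\<^sup>2)"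
    using assms by (auto intro: sum_pos2)
  then have "0 < (1 / \<Lambda>) * (\<Sum>i\<in>first_block m. \<bar>\<xi> i\<bar>\<^sup>2)" using \<Lambda>(1) by simp
  with \<Lambda>(2) show ?thesis by linarith
qed

lemma coefficient_trace_nonneg:
  assumes "\<And>\<xi>. 0 \<le> (\<Sum>i\<in>first_block m. \<Sum>j\<in>first_block m. H i j * \<xi> i * \<xi> j)"
  shows "0 \<le> (\<Sum>i\<in>first_block m. \<Sum>j\<in>first_block m. a i j z * H i j)"
proof (rule trace_product_nonneg[OF finite _ coefficient_pos assms])
  show "a i j z = a j i z" if "i \<in> first_block m" "j \<in> first_block m" for i j
    using kolmogorov that unfolding kolmogorov_operator_def uniformly_elliptic_def by blast
qed

text \<open>
  The barrier \<open>w z = l \<bullet> (z - y) + q (z - y) (z - y)\<close> satisfies \<open>L w > 0\<close> near \<open>y\<close>, so \<open>u - \<epsilon> w\<close>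
  cannot have an interior minimum there. No maximum principle with parabolic boundary is
  needed because the Lie derivative is two-sided.
\<close>

lemma no_touching_barrier:
  assumes bl: "bounded_bilinear q" and sym: "\<And>v w. q v w = q w v"
    and y: "y \<in> \<Omega>" "u y = 0"
    and pos: "0 < (\<Sum>i\<in>first_block m. \<Sum>j\<in>first_block m. a i j y * (2 * q (X_field i) (X_field j)))
        + (\<Sum>j\<in>first_block m. b j y * (l \<bullet> X_field j)) + l \<bullet> Y_field B y"
    and r: "r > 0"
    and touch: "\<And>z. z \<in> ball y r \<Longrightarrow> z \<noteq> y \<Longrightarrow> 0 \<le> l \<bullet> (z - y) + q (z - y) (z - y) \<Longrightarrow> 0 < u z"
  shows False
proof -
  interpret q: bounded_bilinear q by fact
  define w where "w z = l \<bullet> (z - y) + q (z - y) (z - y)" for z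
  \<comment> \<open>The operator applied to \<open>w\<close>: the derivative of \<open>w\<close> in
    direction \<open>v\<close> is \<open>l \<bullet> v + 2 * q (z - y) v\<close> by symmetry of
    \<open>q\<close>, and its second derivatives are given by \<open>2 * q\<close>.\<close>
  define Lw where "Lw z =
      (\<Sum>i\<in>first_block m. \<Sum>j\<in>first_block m. a i j z * (2 * q (X_field i) (X_field j)))
      + (\<Sum>j\<in>first_block m. b j z * (l \<bullet> X_field j + 2 * q (z - y) (X_field j)))
      + (l \<bullet> Y_field B z + 2 * q (z - y) (Y_field B z))" for z
  have hoelder: "hoelder_coefficients m B a b" using kolmogorov by (simp add: kolmogorov_operator_def)
  have "isCont Lw y"
    unfolding Lw_def
    by (intro continuous_intros q.continuous coefficients_isCont[OF hoelder]
        bounded_linear.continuous[OF matrix_vector_mul_bounded_linear])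
  moreover have "0 < Lw y" using pos by (simp add: Lw_def q.zero_left)
  ultimately have "\<forall>\<^sub>F z in nhds y. 0 < Lw z"
    by (intro order_tendstoD(1)[of Lw "Lw y"]) (auto simp: continuous_within tendsto_nhds_iff)
  then obtain r1 where r1: "r1 > 0" "\<And>z. dist z y < r1 \<Longrightarrow> 0 < Lw z"
    unfolding eventually_nhds_metric by blast
  obtain r2 where r2: "r2 > 0" "cball y r2 \<subseteq> \<Omega>"
    using open_domain y by (meson open_contains_cball)
  define \<rho> where "\<rho> = min (min r r1) r2 / 2"
  have \<rho>: "\<rho> > 0" "\<rho> < r" "\<rho> < r1" "\<rho> < r2" using r r1 r2 by (auto simp: \<rho>_def)
  have sub: "cball y \<rho> \<subseteq> \<Omega>" using \<rho>(4) r2(2) by auto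
  have contw: "continuous_on A w" for A
    unfolding w_def by (intro continuous_intros q.continuous_on)
  have contu: "continuous_on A u" if "A \<subseteq> cball y \<rho>" for A
    using continuous_on_u sub that by (blast intro: continuous_on_subset)
  \<comment> \<open>On the part of the sphere where \<open>w\<close> is nonnegative,
    \<open>u\<close> has a positive minimum by compactness and \<open>touch\<close>, which beats a
    small multiple of \<open>w\<close>. Where \<open>w\<close> is negative, \<open>- e * w\<close>
    is positive and \<open>u\<close> nonnegative.\<close>
  obtain e where e: "e > 0" "\<And>z. z \<in> sphere y \<rho> \<Longrightarrow> 0 < u z - e * w z"
  proof -
    define A where "A = sphere y \<rho> \<inter> {z. 0 \<le> w z}"
    have "closed {z. 0 \<le> w z}" using contw[of UNIV] by (intro closed_Collect_le) auto
    then have "compact A" unfolding A_def by (intro compact_Int_closed) auto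
    have uA: "0 < u z" if "z \<in> A" for z
      using touch[of z] that \<rho> by (auto simp: A_def w_def dist_commute)
    have "\<exists>\<delta>>0. \<forall>z\<in>A. \<delta> \<le> u z"
    proof (cases "A = {}")
      case False
      have "A \<subseteq> cball y \<rho>" by (auto simp: A_def)
      from continuous_attains_inf[OF \<open>compact A\<close> False contu[OF this]]
      obtain p where "p \<in> A" "\<forall>z\<in>A. u p \<le> u z" by blast
      then show ?thesis using uA by blast
    qed (auto intro: exI[of _ 1])
    then obtain \<delta> where \<delta>: "\<delta> > 0" "\<And>z. z \<in> A \<Longrightarrow> \<delta> \<le> u z" by blast
    have "bounded (w ` sphere y \<rho>)"
      by (intro compact_imp_bounded compact_continuous_image contw) auto
    then obtain W where W: "W > 0" "\<And>z. z \<in> sphere y \<rho> \<Longrightarrow> \<bar>w z\<bar> \<le> W"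
      unfolding bounded_pos by auto
    show ?thesis
    proof (rule that[of "\<delta> / (2 * W)"])
      show "0 < \<delta> / (2 * W)" using \<delta> W by simp
      fix z assume z: "z \<in> sphere y \<rho>"
      show "0 < u z - \<delta> / (2 * W) * w z"
      proof (cases "0 \<le> w z")
        case True
        have "\<delta> / (2 * W) * w z \<le> \<delta> / (2 * W) * W"
          using W(2)[OF z] \<delta>(1) W(1) by (intro mult_left_mono) auto
        also have "\<dots> < \<delta>" using \<delta> W by simp
        finally show ?thesis using \<delta>(2)[of z] True z by (auto simp: A_def)
      next
        case False
        then have "\<delta> / (2 * W) * w z < 0" using \<delta> W by (intro mult_pos_neg) auto
        moreover have "0 \<le> u z" using z sub by (intro nonneg) auto
        ultimately show ?thesis by linarith
      qed
    qed
  qed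
  define g where "g z = u z - e * w z" for z
  have "cball y \<rho> \<noteq> {}" using \<rho> by simp
  moreover have "continuous_on (cball y \<rho>) g"
    unfolding g_def by (intro continuous_intros contu contw) simp
  ultimately obtain p where p: "p \<in> cball y \<rho>" "\<And>z. z \<in> cball y \<rho> \<Longrightarrow> g p \<le> g z"
    using continuous_attains_inf[OF compact_cball] by blast
  \<comment> \<open>The value at the centre is 0 while \<open>g\<close> is positive on the sphere,
    so the minimum is attained inside.\<close>
  have "g p \<le> 0" using p(2)[of y] \<rho> y by (simp add: g_def w_def q.zero_left)
  then have "p \<notin> sphere y \<rho>" using e(2)[of p] unfolding g_def by (meson not_less)
  then have pb: "p \<in> ball y \<rho>" using p(1) by auto
  then have "p \<in> \<Omega>" using sub ball_subset_cball by blast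
  obtain \<tau> where \<tau>0: "\<tau> > 0" "ball p \<tau> \<subseteq> ball y \<rho>"
    using openE[OF open_ball pb] by blast
  have \<tau>: "p + v \<in> ball y \<rho>" if "norm v < \<tau>" for v
    using that by (intro subsetD[OF \<tau>0(2)]) (simp add: dist_norm)
  \<comment> \<open>First and second order conditions at \<open>p\<close> on one horizontal line at
    a time. Coordinate directions yield the gradient, and all \<xi> together make the horizontal
    Hessian of \<open>g\<close> positive semidefinite.\<close>
  have line: "(\<Sum>i\<in>first_block m. \<xi> i * partial i u p) = e * (l \<bullet> hvec (first_block m) \<xi> + 2 * q (p - y) (hvec (first_block m) \<xi>)) \<and>
      0 \<le> (\<Sum>i\<in>first_block m. \<xi> i * (\<Sum>j\<in>first_block m. \<xi> j * partial j (partial i u) p))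
         - e * (2 * q (hvec (first_block m) \<xi>) (hvec (first_block m) \<xi>))" for \<xi>
  proof -
    let ?I = "first_block m" and ?v = "hvec (first_block m) \<xi>"
    define s where "s = \<tau> / (norm ?v + 1)"
    have pos1: "norm ?v + 1 > 0" by (simp add: add_nonneg_pos)
    have "s > 0" using \<tau>0 by (simp add: s_def add_nonneg_pos)
    have inb: "p + h *\<^sub>R ?v \<in> ball y \<rho>" if "\<bar>h\<bar> < s" for h
    proof (rule \<tau>)
      have "norm (h *\<^sub>R ?v) \<le> \<bar>h\<bar> * (norm ?v + 1)" by (simp add: algebra_simps)
      also have "\<dots> < s * (norm ?v + 1)" using that by (intro mult_strict_right_mono) (auto intro: add_nonneg_pos)
      also have "\<dots> = \<tau>" using pos1 by (simp add: s_def)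
      finally show "norm (h *\<^sub>R ?v) < \<tau>" .
    qed
    define \<phi>' where "\<phi>' h = (\<Sum>i\<in>?I. \<xi> i * partial i u (p + h *\<^sub>R ?v))
        - e * (l \<bullet> ?v + 2 * q (p - y) ?v + 2 * h * q ?v ?v)" for h
    have wline: "w (p + h *\<^sub>R ?v) = w p + h * (l \<bullet> ?v + 2 * q (p - y) ?v) + h\<^sup>2 * q ?v ?v" for h
    proof -
      have "p + h *\<^sub>R ?v - y = (p - y) + h *\<^sub>R ?v" by simp
      then show ?thesis
        unfolding w_def
        by (simp only: inner_add_right inner_scaleR_right q.add_left q.add_right q.scaleR_left q.scaleR_right
            sym[of ?v "p - y"]) (simp add: algebra_simps power2_eq_square)
    qed
    have d1: "((\<lambda>h. g (p + h *\<^sub>R ?v)) has_real_derivative \<phi>' h) (at h)" if "\<bar>h\<bar> < s" for h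
    proof -
      have "p + h *\<^sub>R ?v \<in> \<Omega>" using inb[OF that] sub ball_subset_cball by blast
      then have du: "((\<lambda>h. u (p + h *\<^sub>R ?v)) has_real_derivative
          (\<Sum>i\<in>?I. \<xi> i * partial i u (p + h *\<^sub>R ?v))) (at h)"
        by (intro hvec_line_derivative[OF open_domain] has_partial_u continuous_partial_u)
      have "((\<lambda>h. w p + h * A + h\<^sup>2 * C) has_real_derivative A + 2 * h * C) (at h)" for A C
        by (auto intro!: derivative_eq_intros)
      then show ?thesis unfolding g_def \<phi>'_def wline by (intro DERIV_diff du DERIV_cmult)
    qed
    have "((\<lambda>h. partial i u (p + h *\<^sub>R ?v)) has_real_derivative (\<Sum>j\<in>?I. \<xi> j * partial j (partial i u) p)) (at 0)"
      if "i \<in> ?I" for i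
      using that \<open>p \<in> \<Omega>\<close>
      by (intro hvec_directional_derivative[OF open_domain] has_partial_partial_u continuous_partial_partial_u)
    then have d2: "(\<phi>' has_real_derivative ((\<Sum>i\<in>?I. \<xi> i * (\<Sum>j\<in>?I. \<xi> j * partial j (partial i u) p)) - e * (2 * q ?v ?v))) (at 0)"
      unfolding \<phi>'_def
      by (intro DERIV_diff DERIV_sum DERIV_cmult) (auto intro!: derivative_eq_intros)
    have "g (p + 0 *\<^sub>R ?v) \<le> g (p + h *\<^sub>R ?v)" if "\<bar>h\<bar> < s" for h
      using p(2)[of "p + h *\<^sub>R ?v"] inb[OF that] by simp
    from second_order_minimum[OF \<open>s > 0\<close> d1 d2 this] show ?thesis by (simp add: \<phi>'_def)
  qed
  have grad: "partial k u p = e * (l \<bullet> X_field k + 2 * q (p - y) (X_field k))" if "k \<in> first_block m" for k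
  proof -
    have "hvec (first_block m) (\<lambda>i. of_bool (i = k)) = X_field k"
      using that by (simp add: hvec_def sum.remove[of _ k] flip: zero_prod_def)
    then show ?thesis
      using line[of "\<lambda>i. of_bool (i = k)"] that by (simp add: sum.remove[of _ k])
  qed
  define H where "H i j = partial i (partial j u) p - e * (2 * q (X_field i) (X_field j))" for i j
  have "0 \<le> (\<Sum>i\<in>first_block m. \<Sum>j\<in>first_block m. H i j * \<xi> i * \<xi> j)" for \<xi>
  proof -
    let ?I = "first_block m"
    have "q (hvec ?I \<xi>) (hvec ?I \<xi>) = (\<Sum>i\<in>?I. \<Sum>j\<in>?I. q (X_field i) (X_field j) * \<xi> i * \<xi> j)"
      unfolding hvec_def q.sum_left q.sum_right q.scaleR_left q.scaleR_right
      by (subst sum.swap) (simp add: mult_ac sum_distrib_left)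
    \<comment> \<open>The order of differentiation is reversed by renaming summation indices, not by
      symmetry of second derivatives.\<close>
    moreover have "(\<Sum>i\<in>?I. \<xi> i * (\<Sum>j\<in>?I. \<xi> j * partial j (partial i u) p)) =
        (\<Sum>i\<in>?I. \<Sum>j\<in>?I. partial i (partial j u) p * \<xi> i * \<xi> j)"
      unfolding sum_distrib_left by (subst sum.swap) (simp add: mult_ac)
    ultimately have "0 \<le> (\<Sum>i\<in>?I. \<Sum>j\<in>?I. partial i (partial j u) p * \<xi> i * \<xi> j)
        - e * (2 * (\<Sum>i\<in>?I. \<Sum>j\<in>?I. q (X_field i) (X_field j) * \<xi> i * \<xi> j))"
      using line[of \<xi>] by simp
    also have "\<dots> = (\<Sum>i\<in>?I. \<Sum>j\<in>?I. H i j * \<xi> i * \<xi> j)"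
      by (simp add: H_def sum_subtractf sum_distrib_left algebra_simps)
    finally show ?thesis .
  qed
  then have trace: "0 \<le> (\<Sum>i\<in>first_block m. \<Sum>j\<in>first_block m. a i j p * H i j)"
    by (rule coefficient_trace_nonneg)
  have lie: "lie_deriv B u p = e * (l \<bullet> Y_field B p + 2 * q (p - y) (Y_field B p))"
  proof -
    define Yp where "Yp = Y_field B p"
    have dY: "(Y_curve B p has_derivative (\<lambda>h. h *\<^sub>R Yp)) (at 0)"
      using Y_curve_has_vector_derivative[of B p 0] by (simp add: has_vector_derivative_def Yp_def)
    have "((\<lambda>s. w (Y_curve B p s)) has_derivative (\<lambda>h. h * (l \<bullet> Yp + 2 * q (p - y) Yp))) (at 0)"
      unfolding w_def
      by (rule has_derivative_eq_rhs, (rule derivative_intros q.FDERIV dY)+)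
         (auto simp: fun_eq_iff q.scaleR_left q.scaleR_right sym[of _ "p - y"] algebra_simps)
    then have "((\<lambda>s. w (Y_curve B p s)) has_derivative
        (\<lambda>h. h * (l \<bullet> Y_field B p + 2 * q (p - y) (Y_field B p)))) (at 0)"
      by (simp only: Yp_def)
    then have "((\<lambda>s. w (Y_curve B p s)) has_real_derivative l \<bullet> Y_field B p + 2 * q (p - y) (Y_field B p)) (at 0)"
      by (simp add: has_field_derivative_def mult_commute_abs)
    moreover have "((\<lambda>s. u (Y_curve B p s)) has_real_derivative lie_deriv B u p) (at 0)"
      using lie_derivative_along_flow[of p 0] \<open>p \<in> \<Omega>\<close> by simp
    ultimately have dg: "((\<lambda>s. g (Y_curve B p s)) has_real_derivative
        lie_deriv B u p - e * (l \<bullet> Y_field B p + 2 * q (p - y) (Y_field B p))) (at 0)"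
      unfolding g_def by (intro DERIV_diff DERIV_cmult)
    have "(Y_curve B p \<longlongrightarrow> p) (at 0)"
      using tendsto_Y_curve[OF tendsto_const tendsto_ident_at, of B p 0] by simp
    then have "\<forall>\<^sub>F s in at 0. Y_curve B p s \<in> ball y \<rho>" using pb by (intro topological_tendstoD) auto
    then obtain d where d: "d > 0" "\<And>s. s \<noteq> 0 \<Longrightarrow> \<bar>s\<bar> < d \<Longrightarrow> Y_curve B p s \<in> ball y \<rho>"
      unfolding eventually_at by (auto simp: dist_real_def)
    have "g (Y_curve B p 0) \<le> g (Y_curve B p s)" if "\<bar>0 - s\<bar> < d" for s
      using p(2)[of "Y_curve B p s"] d(2)[of s] that by (cases "s = 0") auto
    then have "lie_deriv B u p - e * (l \<bullet> Y_field B p + 2 * q (p - y) (Y_field B p)) = 0"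
      by (intro DERIV_local_min[OF dg d(1)]) auto
    then show ?thesis by simp
  qed
  have "(\<Sum>i\<in>first_block m. \<Sum>j\<in>first_block m. a i j p * H i j) =
      (\<Sum>i\<in>first_block m. \<Sum>j\<in>first_block m. a i j p * partial i (partial j u) p)
      - e * (\<Sum>i\<in>first_block m. \<Sum>j\<in>first_block m. a i j p * (2 * q (X_field i) (X_field j)))"
    by (simp add: H_def right_diff_distrib sum_subtractf sum_distrib_left mult_ac)
  moreover have "(\<Sum>j\<in>first_block m. b j p * partial j u p) =
      e * (\<Sum>j\<in>first_block m. b j p * (l \<bullet> X_field j + 2 * q (p - y) (X_field j)))"
    unfolding sum_distrib_left by (intro sum.cong refl) (simp add: grad mult.left_commute)
  \<comment> \<open>The equation for \<open>u\<close> and the first-order conditions at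
    \<open>p\<close> turn the trace into a negative number, against \<open>trace\<close>.\<close>
  ultimately have "(\<Sum>i\<in>first_block m. \<Sum>j\<in>first_block m. a i j p * H i j) = - (e * Lw p)"
    using equation[OF \<open>p \<in> \<Omega>\<close>] lie unfolding Lw_def by (simp only: distrib_left)
  moreover have "0 < e * Lw p" using e(1) r1(2)[of p] pb \<rho>(3) by (simp add: dist_commute)
  ultimately show False using trace by linarith
qed

section \<open>Normals to the zero set\<close>

definition zero_set :: "'n point set" where
  "zero_set = {z \<in> \<Omega>. u z = 0}"

lemma closedin_zero_set: "closedin (top_of_set \<Omega>) zero_set"
  unfolding zero_set_def by (rule continuous_closedin_preimage_constant[OF continuous_on_u])

text \<open>As \<open>u\<close> is nonnegative, missing the zero set inside \<Omega> means
  \<open>0 < u\<close>, which is the form in which the barrier lemma needs it.\<close>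

lemma outer_normal_pos:
  assumes "outer_normal zero_set y \<nu>"
  shows "y \<in> \<Omega>" "u y = 0"
    and "\<exists>r>0. ball y r \<subseteq> \<Omega> \<and> (\<forall>z\<in>ball y r. (norm (z - y))\<^sup>2 < 2 * (\<nu> \<bullet> (z - y)) \<longrightarrow> 0 < u z)"
proof -
  show y: "y \<in> \<Omega>" "u y = 0" using assms by (auto simp: outer_normal_def zero_set_def)
  obtain r1 where r1: "r1 > 0" "\<And>z. z \<in> ball y r1 \<Longrightarrow> (norm (z - y))\<^sup>2 < 2 * (\<nu> \<bullet> (z - y)) \<Longrightarrow> z \<notin> zero_set"
    using assms by (auto simp: outer_normal_def)
  obtain r2 where r2: "r2 > 0" "ball y r2 \<subseteq> \<Omega>"
    using open_domain y by (meson open_contains_ball)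
  have "0 < u z" if "z \<in> ball y (min r1 r2)" "(norm (z - y))\<^sup>2 < 2 * (\<nu> \<bullet> (z - y))" for z
    using r1(2)[of z] r2(2) nonneg[of z] that by (force simp: zero_set_def)
  moreover have "ball y (min r1 r2) \<subseteq> \<Omega>" using r2(2) by auto
  ultimately show "\<exists>r>0. ball y r \<subseteq> \<Omega> \<and> (\<forall>z\<in>ball y r. (norm (z - y))\<^sup>2 < 2 * (\<nu> \<bullet> (z - y)) \<longrightarrow> 0 < u z)"
    using r1(1) r2(1) by (intro exI[of _ "min r1 r2"]) auto
qed

text \<open>If \<open>\<nu> \<bullet> X_field k \<noteq> 0\<close>, then the curvature term \<open>K (l \<bullet> (z - y))\<^sup>2\<close> makes the barrier a strict subsolution.\<close>

lemma outer_normal_orthogonal_X_field: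
  assumes on: "outer_normal zero_set y \<nu>" and k: "k \<in> first_block m"
  shows "\<nu> \<bullet> X_field k = 0"
proof (rule ccontr)
  assume nz: "\<nu> \<bullet> X_field k \<noteq> 0"
  obtain r where r: "r > 0" "\<And>z. z \<in> ball y r \<Longrightarrow> (norm (z - y))\<^sup>2 < 2 * (\<nu> \<bullet> (z - y)) \<Longrightarrow> 0 < u z"
    using outer_normal_pos(3)[OF on] by blast
  define l where "l = 2 *\<^sub>R \<nu>"
  define S where "S = (\<Sum>i\<in>first_block m. \<Sum>j\<in>first_block m. a i j y * (l \<bullet> X_field i) * (l \<bullet> X_field j))"
  define T where "T = (\<Sum>i\<in>first_block m. \<Sum>j\<in>first_block m. a i j y * (X_field i \<bullet> X_field j))"
  define R where "R = (\<Sum>j\<in>first_block m. b j y * (l \<bullet> X_field j)) + l \<bullet> Y_field B y"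
  have "S > 0" unfolding S_def using nz k by (intro coefficient_pos) (auto simp: l_def)
  \<comment> \<open>The operator applied to the barrier gives \<open>2 * K * S - 4 * T + R\<close>
    at \<open>y\<close>; this \<open>K\<close> makes it at least 1.\<close>
  define K where "K = (\<bar>4 * T - R\<bar> + 1) / (2 * S)"
  have K: "K > 0" "2 * K * S = \<bar>4 * T - R\<bar> + 1" using \<open>S > 0\<close> by (auto simp: K_def add_nonneg_pos)
  \<comment> \<open>Nonnegativity of the barrier at \<open>z\<close> reads
    \<open>2 * (norm (z - y))\<^sup>2 \<le> ?s * (1 + K * ?s)\<close> with
    \<open>?s = l \<bullet> (z - y)\<close>. The radius \<open>r'\<close> makes
    \<open>\<bar>K * ?s\<bar> < 1\<close>, and the factor 2 absorbs this, so that \<open>z\<close>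
    lies in the open ball belonging to the outer normal.\<close>
  define q where "q v w = K * (l \<bullet> v) * (l \<bullet> w) - 2 * (v \<bullet> w)" for v w :: "'n point"
  define r' where "r' = min r (1 / (K * norm l + 1))"
  show False
  proof (rule no_touching_barrier[of q y l r'])
    show "bounded_bilinear q"
      unfolding bilinear_conv_bounded_bilinear[symmetric] bilinear_def linear_iff q_def
      by (auto simp: inner_add_left inner_add_right algebra_simps)
    show "q v w = q w v" for v w by (simp add: q_def inner_commute)
    show "y \<in> \<Omega>" "u y = 0" using outer_normal_pos[OF on] by auto
    show "r' > 0" using r(1) K(1) by (auto simp: r'_def intro!: divide_pos_pos add_nonneg_pos)
    have "(\<Sum>i\<in>first_block m. \<Sum>j\<in>first_block m. a i j y * (2 * q (X_field i) (X_field j))) = 2 * K * S - 4 * T"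
      unfolding S_def T_def q_def sum_distrib_left sum_subtractf[symmetric]
      by (intro sum.cong refl) (simp only: algebra_simps)
    then show "0 < (\<Sum>i\<in>first_block m. \<Sum>j\<in>first_block m. a i j y * (2 * q (X_field i) (X_field j)))
        + (\<Sum>j\<in>first_block m. b j y * (l \<bullet> X_field j)) + l \<bullet> Y_field B y"
      using K(2) unfolding R_def by linarith
    fix z assume z: "z \<in> ball y r'" "z \<noteq> y" and w: "0 \<le> l \<bullet> (z - y) + q (z - y) (z - y)"
    let ?s = "l \<bullet> (z - y)"
    have "0 < (norm (z - y))\<^sup>2" using z by simp
    have w': "2 * (norm (z - y))\<^sup>2 \<le> ?s * (1 + K * ?s)"
      using w by (simp add: q_def power2_norm_eq_inner algebra_simps)
    have den: "K * norm l + 1 > 0" using K(1) by (intro add_nonneg_pos) auto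
    have "\<bar>K * ?s\<bar> \<le> K * (norm l * norm (z - y))"
      using K(1) Cauchy_Schwarz_ineq2[of l "z - y"] by (simp add: abs_mult)
    also have "\<dots> \<le> (K * norm l + 1) * norm (z - y)" by (simp add: algebra_simps)
    also have "\<dots> < (K * norm l + 1) * (1 / (K * norm l + 1))"
      using z(1) den by (intro mult_strict_left_mono) (auto simp: r'_def dist_norm norm_minus_commute)
    also have "\<dots> = 1" using den by simp
    finally have small: "\<bar>K * ?s\<bar> < 1" .
    have "?s > 0"
    proof (rule ccontr)
      assume "\<not> ?s > 0"
      then have "?s * (1 + K * ?s) \<le> 0" using small by (intro mult_nonpos_nonneg) auto
      then show False using w' \<open>0 < (norm (z - y))\<^sup>2\<close> by linarith
    qed
    then have "?s * (1 + K * ?s) < ?s * 2" using small by (intro mult_strict_left_mono) auto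
    then have "(norm (z - y))\<^sup>2 < 2 * (\<nu> \<bullet> (z - y))" using w' by (simp add: l_def)
    then show "0 < u z" using z(1) by (intro r(2)) (auto simp: r'_def)
  qed
qed

lemma inner_hvec: "v \<bullet> hvec J \<xi> = (\<Sum>i\<in>J. \<xi> i * (v \<bullet> X_field i))"
  by (simp only: hvec_def inner_sum_right inner_scaleR_right)

text \<open>The velocity of a horizontal segment is orthogonal to all outer normals, so the
  invariance criterion applies with constant 0.\<close>

lemma zero_set_horizontal_invariant:
  assumes z: "z \<in> zero_set"
    and seg: "\<And>s. 0 \<le> s \<Longrightarrow> s \<le> 1 \<Longrightarrow> z + s *\<^sub>R hvec (first_block m) \<xi> \<in> \<Omega>"
  shows "z + hvec (first_block m) \<xi> \<in> zero_set"
proof -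
  let ?v = "hvec (first_block m) \<xi>"
  let ?\<gamma> = "\<lambda>s. z + s *\<^sub>R ?v"
  have "?\<gamma> 1 \<in> zero_set"
  proof (rule invariant_along_curve[OF open_domain closedin_zero_set absolutely_continuous_curve_line])
    show "(0::real) \<le> 1" "(0::real) \<le> 0" "negligible ({} :: real set)" by auto
    show "?\<gamma> ` {0..1} \<subseteq> \<Omega>" using seg by auto
    show "?\<gamma> 0 \<in> zero_set" using z by simp
    fix s :: real
    have "(?\<gamma> has_vector_derivative ?v) (at s within {0..1})"
      by (auto intro!: derivative_eq_intros)
    moreover have "\<mu> \<bullet> ?v \<le> 0 * (norm \<mu>)\<^sup>2" if "outer_normal zero_set y \<mu>" for y \<mu>
      using outer_normal_orthogonal_X_field[OF that] by (simp add: inner_hvec)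
    ultimately show "\<exists>v. (?\<gamma> has_vector_derivative v) (at s within {0..1}) \<and>
        (\<forall>y. outer_normal zero_set y (?\<gamma> s - y) \<longrightarrow> (?\<gamma> s - y) \<bullet> v \<le> 0 * (norm (?\<gamma> s - y))\<^sup>2)"
      by blast
  qed
  then show ?thesis by simp
qed

text \<open>
  By horizontal invariance the zero set is locally a cylinder in the directions \<open>X_field i\<close>, so the
  barrier may be taken arbitrarily flat in these directions.
\<close>

lemma outer_normal_Y_field_nonpos:
  assumes on: "outer_normal zero_set y \<nu>"
  shows "\<nu> \<bullet> Y_field B y \<le> 0"
proof (rule ccontr)
  define D where "D = \<nu> \<bullet> Y_field B y"
  assume "\<not> \<nu> \<bullet> Y_field B y \<le> 0"
  then have "D > 0" by (simp add: D_def)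
  obtain r where r: "r > 0" "ball y r \<subseteq> \<Omega>"
      "\<And>z. z \<in> ball y r \<Longrightarrow> (norm (z - y))\<^sup>2 < 2 * (\<nu> \<bullet> (z - y)) \<Longrightarrow> 0 < u z"
    using outer_normal_pos(3)[OF on] by blast
  let ?I = "first_block m"
  \<comment> \<open>\<open>P\<close> is the orthogonal projection onto the span of the horizontal
    fields, and \<open>Q\<close> is the bilinear form belonging to it.\<close>
  define P where "P v = hvec ?I (\<lambda>i. v \<bullet> X_field i)" for v :: "'n point"
  define Q where "Q v w = (\<Sum>i\<in>?I. (v \<bullet> X_field i) * (w \<bullet> X_field i))" for v w :: "'n point"
  have XX: "X_field i \<bullet> X_field j = of_bool (i = j)" for i j :: 'n
    by (simp add: inner_axis_axis)
  have QX: "Q (X_field i) (X_field j) = X_field i \<bullet> X_field j" if "i \<in> ?I" for i j :: 'n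
  proof -
    have "Q (X_field i) (X_field j) = (\<Sum>k\<in>?I. of_bool (i = k) * (X_field j \<bullet> X_field k))"
      unfolding Q_def XX[of i] ..
    also have "\<dots> = X_field j \<bullet> X_field i"
      using that by (subst sum.remove[of _ i]) (auto intro!: sum.neutral)
    finally show ?thesis by (simp add: inner_commute)
  qed
  have vP: "v \<bullet> P w = Q w v" for v w by (simp only: P_def Q_def inner_hvec)
  have PX: "P w \<bullet> X_field j = w \<bullet> X_field j" if "j \<in> ?I" for w and j :: 'n
  proof -
    have "P w \<bullet> X_field j = (\<Sum>i\<in>?I. (w \<bullet> X_field i) * (X_field j \<bullet> X_field i))"
      by (simp only: P_def inner_hvec inner_commute[of "hvec _ _"])
    also have "\<dots> = (\<Sum>i\<in>?I. (w \<bullet> X_field i) * of_bool (j = i))" by (simp only: XX)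
    also have "\<dots> = w \<bullet> X_field j" using that by (subst sum.remove[of _ j]) (auto intro!: sum.neutral)
    finally show ?thesis .
  qed
  have PP: "P v \<bullet> P v = Q v v" for v
    unfolding vP unfolding Q_def by (intro sum.cong refl) (simp only: PX)
  have "\<nu> \<bullet> P v = 0" for v
    unfolding P_def inner_hvec using outer_normal_orthogonal_X_field[OF on]
    by (intro sum.neutral) simp
  then have \<nu>P: "\<nu> \<bullet> (v - P v) = \<nu> \<bullet> v" for v by (simp add: inner_diff_right)
  have Pv: "v \<bullet> P v = Q v v" "P v \<bullet> v = Q v v" for v by (simp_all only: vP inner_commute[of "P v"])
  have normP: "(norm (v - P v))\<^sup>2 = v \<bullet> v - Q v v" for v
    unfolding power2_norm_eq_inner by (simp add: inner_diff_left inner_diff_right Pv PP)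
  define T where "T = (\<Sum>i\<in>?I. \<Sum>j\<in>?I. a i j y * (X_field i \<bullet> X_field j))"
  \<comment> \<open>The operator applied to the barrier gives \<open>2 * D - 2 * c * T\<close> at
    \<open>y\<close>, which this choice keeps positive.\<close>
  define c where "c = D / (\<bar>T\<bar> + 1)"
  have "c > 0" using \<open>D > 0\<close> by (simp add: c_def)
  have "c * T < D"
  proof -
    have "c * T \<le> c * \<bar>T\<bar>" using \<open>c > 0\<close> by (intro mult_left_mono) auto
    also have "\<dots> < c * (\<bar>T\<bar> + 1)" using \<open>c > 0\<close> by simp
    also have "\<dots> = D" by (simp add: c_def add_nonneg_pos)
    finally show ?thesis .
  qed
  \<comment> \<open>On the diagonal this is
    \<open>- 2 * (norm (v - P v))\<^sup>2 - c * (norm (P v))\<^sup>2\<close>: small curvature in the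
    horizontal directions, and in the others twice that of the touching ball, which makes the
    inclusion strict.\<close>
  define q where "q v w = (2 - c) * Q v w - 2 * (v \<bullet> w)" for v w :: "'n point"
  show False
  proof (rule no_touching_barrier[of q y "2 *\<^sub>R \<nu>" r])
    show "bounded_bilinear q"
      unfolding bilinear_conv_bounded_bilinear[symmetric] bilinear_def linear_iff q_def Q_def
      by (auto simp: inner_add_left inner_add_right sum.distrib sum_distrib_left algebra_simps)
    show "q v w = q w v" for v w by (simp add: q_def Q_def inner_commute mult.commute)
    show "y \<in> \<Omega>" "u y = 0" using outer_normal_pos[OF on] by auto
    show "r > 0" by fact
    have "(\<Sum>i\<in>?I. \<Sum>j\<in>?I. a i j y * (2 * q (X_field i) (X_field j))) = - 2 * c * T"
      unfolding T_def q_def sum_distrib_left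
      by (intro sum.cong refl) (simp only: QX, simp only: algebra_simps)
    moreover have "(\<Sum>j\<in>?I. b j y * (2 *\<^sub>R \<nu> \<bullet> X_field j)) = 0"
      using outer_normal_orthogonal_X_field[OF on] by (intro sum.neutral) (simp only: inner_scaleR_left, simp)
    moreover have "2 *\<^sub>R \<nu> \<bullet> Y_field B y = 2 * D" by (simp only: inner_scaleR_left D_def)
    ultimately show "0 < (\<Sum>i\<in>?I. \<Sum>j\<in>?I. a i j y * (2 * q (X_field i) (X_field j)))
        + (\<Sum>j\<in>?I. b j y * (2 *\<^sub>R \<nu> \<bullet> X_field j)) + 2 *\<^sub>R \<nu> \<bullet> Y_field B y"
      using \<open>c * T < D\<close> by linarith
    fix z assume z: "z \<in> ball y r" "z \<noteq> y" and w: "0 \<le> 2 *\<^sub>R \<nu> \<bullet> (z - y) + q (z - y) (z - y)"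
    have zr: "norm (z - y) < r" using z(1) by (simp add: dist_norm norm_minus_commute)
    define v where "v = z - y"
    have w': "2 * (norm (v - P v))\<^sup>2 + c * (P v \<bullet> P v) \<le> 2 * (\<nu> \<bullet> (v - P v))"
      using w unfolding \<nu>P normP PP by (simp add: q_def v_def algebra_simps)
    show "0 < u z"
    \<comment> \<open>If \<open>u z = 0\<close>, then \<open>z\<close> can be slid horizontally to
      \<open>z - P v\<close> inside the zero set, the distance to \<open>y\<close> never exceeding
      \<open>norm v\<close>. But by \<open>w'\<close> the end point lies in the ball where
      \<open>u\<close> is positive.\<close>
    proof (rule ccontr)
      assume "\<not> 0 < u z"
      then have "z \<in> zero_set" using nonneg[of z] r(2) z(1) by (force simp: zero_set_def)
      have path: "norm (v - s *\<^sub>R P v) \<le> norm v" if "0 \<le> s" "s \<le> 1" for s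
      proof (rule power2_le_imp_le)
        have "(norm (v - s *\<^sub>R P v))\<^sup>2 = (norm v)\<^sup>2 - s * (2 - s) * Q v v"
          unfolding power2_norm_eq_inner
          by (simp add: inner_diff_left inner_diff_right Pv PP algebra_simps)
        moreover have "0 \<le> Q v v" unfolding Q_def by (intro sum_nonneg) auto
        ultimately show "(norm (v - s *\<^sub>R P v))\<^sup>2 \<le> (norm v)\<^sup>2" using that by simp
      qed simp
      have mP: "- P v = hvec ?I (\<lambda>i. - (v \<bullet> X_field i))"
        by (simp add: P_def hvec_def sum_negf[symmetric] del: scaleR_Pair)
      have "z + - P v \<in> zero_set"
        unfolding mP
      proof (rule zero_set_horizontal_invariant[OF \<open>z \<in> zero_set\<close>])
        fix s :: real assume s: "0 \<le> s" "s \<le> 1"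
        have "norm (z + s *\<^sub>R (- P v) - y) < r"
          using path[OF s] zr by (simp add: v_def algebra_simps)
        then have "z + s *\<^sub>R (- P v) \<in> ball y r" by (simp add: dist_norm norm_minus_commute)
        then show "z + s *\<^sub>R hvec ?I (\<lambda>i. - (v \<bullet> X_field i)) \<in> \<Omega>" using r(2) unfolding mP by blast
      qed
      moreover have eq: "z + - P v - y = v - P v" by (simp add: v_def)
      have "0 < u (z + - P v)"
      proof (rule r(3))
        show "z + - P v \<in> ball y r"
          unfolding mem_ball dist_norm norm_minus_commute[of y] eq
          using path[of 1] zr unfolding v_def[symmetric] by simp
        show "(norm (z + - P v - y))\<^sup>2 < 2 * (\<nu> \<bullet> (z + - P v - y))"
        proof (cases "v - P v = 0")
          \<comment> \<open>The end point would be \<open>y\<close> itself; then \<open>w'\<close>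
            forces \<open>P v = 0\<close>, contradicting \<open>z \<noteq> y\<close>.\<close>
          case True
          then have "c * (P v \<bullet> P v) \<le> 0" using w' by simp
          then have "P v \<bullet> P v \<le> 0" using \<open>c > 0\<close> by (simp add: mult_le_0_iff)
          then have "P v = 0" using inner_ge_zero[of "P v"] by (metis inner_eq_zero_iff order_antisym)
          then show ?thesis using True z(2) by (simp add: v_def)
        next
          case False
          then have "0 < (norm (v - P v))\<^sup>2" by simp
          moreover have "0 \<le> c * (P v \<bullet> P v)" using \<open>c > 0\<close> by simp
          ultimately show ?thesis unfolding eq using w' by linarith
        qed
      qed
      ultimately show False by (simp add: zero_set_def)
    qed
  qed
qed

section \<open>Propagation along admissible curves\<close>

text \<open>The sign of \<nu> \<bullet> Y is known at the nearest point \<open>y\<close>, but the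
  velocity is taken at \<open>\<gamma> s\<close>. The horizontal part of the velocity is orthogonal
  to \<nu>, and replacing \<open>\<gamma> s\<close> by \<open>y\<close> in the drift costs at most
  \<open>C * (norm \<nu>)\<^sup>2\<close>, where \<open>C\<close> bounds \<open>B\<close>.\<close>

lemma zero_set_admissible_invariant:
  assumes adm: "admissible_curve m B T \<gamma>" and "T \<ge> 0" and "\<gamma> ` {0..T} \<subseteq> \<Omega>" and "\<gamma> 0 \<in> zero_set"
  shows "\<gamma> T \<in> zero_set"
proof -
  obtain \<omega> where ac: "absolutely_continuous_curve 0 T \<gamma>"
    and AE: "AE s in lebesgue_on {0..T}. (\<gamma> has_vector_derivative
              ((\<Sum>k\<in>first_block m. \<omega> k s *\<^sub>R X_field k) + Y_field B (\<gamma> s))) (at s within {0..T})"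
    using adm unfolding admissible_curve_def by blast
  then have "AE s in lebesgue. s \<in> {0..T} \<longrightarrow> (\<gamma> has_vector_derivative
              ((\<Sum>k\<in>first_block m. \<omega> k s *\<^sub>R X_field k) + Y_field B (\<gamma> s))) (at s within {0..T})"
    by (subst (asm) AE_restrict_space_iff) auto
  then obtain N where N: "N \<in> null_sets lebesgue"
    and der: "\<And>s. s \<in> {0..T} - N \<Longrightarrow> (\<gamma> has_vector_derivative
              ((\<Sum>k\<in>first_block m. \<omega> k s *\<^sub>R X_field k) + Y_field B (\<gamma> s))) (at s within {0..T})"
    by (auto elim!: AE_E3)
  obtain C where C: "C > 0" "\<And>x. norm (B *v x) \<le> norm x * C"
    using bounded_linear.pos_bounded[OF matrix_vector_mul_bounded_linear, of B] by blast
  show ?thesis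
  proof (rule invariant_along_curve[OF open_domain closedin_zero_set ac assms(2-4)])
    show "0 \<le> C" using C by simp
    show "negligible N" using N by (simp add: negligible_iff_null_sets)
    fix s assume s: "s \<in> {0..T} - N"
    let ?v = "(\<Sum>k\<in>first_block m. \<omega> k s *\<^sub>R X_field k) + Y_field B (\<gamma> s)"
    have "(\<gamma> s - y) \<bullet> ?v \<le> C * (norm (\<gamma> s - y))\<^sup>2" if on: "outer_normal zero_set y (\<gamma> s - y)" for y
    proof -
      define \<nu> where "\<nu> = \<gamma> s - y"
      have "norm (fst \<nu>) \<le> norm \<nu>" by (metis norm_fst_le prod.collapse)
      then have B\<nu>: "norm (B *v fst \<nu>) \<le> norm \<nu> * C"
        using C(2)[of "fst \<nu>"] C(1) mult_right_mono[of "norm (fst \<nu>)" "norm \<nu>" C] by linarith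
      note on' = on[folded \<nu>_def]
      have Y: "Y_field B (\<gamma> s) = Y_field B y + (B *v fst \<nu>, 0)"
        by (simp add: \<nu>_def matrix_vector_mult_diff_distrib)
      have "\<nu> \<bullet> ?v = \<nu> \<bullet> hvec (first_block m) (\<lambda>k. \<omega> k s) + \<nu> \<bullet> Y_field B y + \<nu> \<bullet> (B *v fst \<nu>, 0)"
        unfolding Y hvec_def by (simp only: inner_add_right add.assoc)
      also have "\<nu> \<bullet> hvec (first_block m) (\<lambda>k. \<omega> k s) = 0"
        using outer_normal_orthogonal_X_field[OF on'] unfolding inner_hvec by (intro sum.neutral) simp
      also have "\<nu> \<bullet> (B *v fst \<nu>, 0) \<le> norm \<nu> * norm (B *v fst \<nu>)"
        using norm_cauchy_schwarz[of \<nu> "(B *v fst \<nu>, 0)"] by (simp add: norm_Pair)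
      also have "\<dots> \<le> norm \<nu> * (norm \<nu> * C)"
        using B\<nu> by (intro mult_left_mono) auto
      finally have "\<nu> \<bullet> ?v \<le> norm \<nu> * (norm \<nu> * C)"
        using outer_normal_Y_field_nonpos[OF on'] by linarith
      then show ?thesis unfolding \<nu>_def by (simp add: power2_eq_square mult_ac)
    qed
    then show "\<exists>v. (\<gamma> has_vector_derivative v) (at s within {0..T}) \<and>
        (\<forall>y. outer_normal zero_set y (\<gamma> s - y) \<longrightarrow> (\<gamma> s - y) \<bullet> v \<le> C * (norm (\<gamma> s - y))\<^sup>2)"
      using der[OF s] by blast
  qed
qed

lemma closure_attainable_set_subset_zero_set:
  assumes "z\<^sub>0 \<in> zero_set"
  shows "closure (attainable_set m B \<Omega> z\<^sub>0) \<inter> \<Omega> \<subseteq> zero_set"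
proof -
  obtain T where T: "closed T" "zero_set = \<Omega> \<inter> T"
    using closedin_zero_set by (auto simp: closedin_closed)
  have "attainable_set m B \<Omega> z\<^sub>0 \<subseteq> zero_set"
  proof
    fix z assume "z \<in> attainable_set m B \<Omega> z\<^sub>0"
    then obtain T \<gamma> where "T \<ge> 0" "admissible_curve m B T \<gamma>" "\<gamma> ` {0..T} \<subseteq> \<Omega>" "\<gamma> 0 = z\<^sub>0" "\<gamma> T = z"
      unfolding attainable_set_def by blast
    then show "z \<in> zero_set" using zero_set_admissible_invariant[of T \<gamma>] assms by simp
  qed
  then have "closure (attainable_set m B \<Omega> z\<^sub>0) \<subseteq> T"
    using T by (intro closure_minimal) auto
  then show ?thesis using T(2) by blast
qed

end

theorem theorem4p6:
  fixes B :: "'n::{finite,linorder} sqmat"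
    and a :: "'n \<Rightarrow> 'n \<Rightarrow> 'n point \<Rightarrow> real"
    and b :: "'n \<Rightarrow> 'n point \<Rightarrow> real"
    and \<kappa> :: nat and m :: "nat \<Rightarrow> nat"
    and \<Omega> :: "'n point set"
    and u :: "'n point \<Rightarrow> real"
    and x\<^sub>0 :: "(real, 'n) vec" and t\<^sub>0 :: real
  assumes "kolmogorov_operator \<kappa> m B a b"
    and "open \<Omega>"
    and "is_solution m B a b \<Omega> u"
    and "\<forall>z\<in>\<Omega>. 0 \<le> u z"
    and "(x\<^sub>0, t\<^sub>0) \<in> \<Omega>"
    and "u (x\<^sub>0, t\<^sub>0) = 0"
  shows "\<forall>(x, t) \<in> closure (attainable_set m B \<Omega> (x\<^sub>0, t\<^sub>0)) \<inter> \<Omega>. u (x, t) = 0"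
proof -
  interpret kolmogorov_solution \<kappa> m B a b \<Omega> u
    using assms by unfold_locales auto
  have "(x\<^sub>0, t\<^sub>0) \<in> zero_set" using assms by (simp add: zero_set_def)
  from closure_attainable_set_subset_zero_set[OF this] show ?thesis
    by (auto simp: zero_set_def)
qed

end
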